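(* Consider a dynamic generalized factor analysis (DGFA) model and its truncations $$\mathbf x(t+1)=A\mathbf x(t)+\mathbf v(t),\qquad \mathbf y_N(t)=C_N\mathbf x(t)+\mathbf w_N(t),\qquad N=1,2,\dots$$ satisfying all the standing assumptions (A)–(F) listed in the context. For each $N$ let $\hat{\mathbf x}_N(t\mid t-1)$ be the steady-state one-step-ahead Kalman predictor and consider the steady-state innovation representation $$\hat{\mathbf x}_N(t+1\mid t)=A\hat{\mathbf x}_N(t\mid t-1)+K_N\mathbf e_N(t),\qquad \mathbf y_N(t)=C_N\hat{\mathbf x}_N(t\mid t-1)+\mathbf e_N(t),$$ where $\mathbf e_N(t)=\mathbf y_N(t)-C_N\hat{\mathbf x}_N(t\mid t-1)$ is the innovation, with covariance $\Lambda_N=\mathbb E[\mathbf e_N(t)\mathbf e_N(t)^\top]$. Then, as $N\to\infty$, the innovation process $\mathbf e_N$ does not tend to an idiosyncratic process, that is, the covariance matrices $\Lambda_N$ are not bounded in operator norm uniformly in $N$: $\sup_N\|\Lambda_N\|=\infty$. Hence for $N\to\infty$ the innovation model does not tend to a legitimate DGFA model (its output noise is not idiosyncratic in the limit).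
   Context: All random variables are real, zero-mean, with finite variance; $^\top$ is transpose, $\|\cdot\|$ on matrices is the operator (spectral) norm. Model. Time is $t\in\mathbb Z$. The infinite-dimensional model is $\mathbf x(t+1)=A\mathbf x(t)+\mathbf v(t)$, $\mathbf y(t)=C\mathbf x(t)+\mathbf w(t)$, where $\mathbf x(t)$ and $\mathbf v(t)$ are $n$-dimensional ($n\ge 1$ fixed), $\mathbf y(t),\mathbf w(t)$ are random vectors with countably many components, and $C$ is an $\infty\times n$ real matrix. $\mathbf y_N(t)$, $\mathbf w_N(t)$ denote the vectors of the first $N$ components of $\mathbf y(t)$, $\mathbf w(t)$, and $C_N\in\mathbb R^{N\times n}$ consists of the first $N$ rows of $C$. Standing assumptions: (A) $A\in\mathbb R^{n\times n}$ is asymptotically stable (all eigenvalues of modulus $<1$), $\mathbf v$ is a white noise with covariance $Q$, and $\mathbf x$ is the stationary process solving the state equation. (B) $\mathbf w$ is a stationary white noise (in $t$), uncorrelated with $\mathbf v$ at all times; its components need not be mutually uncorrelated. (C) The columns of $C$ are strongly linearly independent, i.e. $\lim_{N\to\infty}\lambda_{\min}[C_N^\top C_N]=+\infty$, with $\lambda_{\min}$ the smallest eigenvalue. (D) $\mathbf w(0)$ (hence $\mathbf w(t)$ for every $t$) is an idiosyncratic sequence with respect to the cross-sectional index; equivalently, with $R_N:=\mathbb E[\mathbf w_N(t)\mathbf w_N(t)^\top]$, $\sup_N\|R_N\|<\infty$. (E) The model is wide-sense stationary and minimal, so that $(A,Q)$ is reachable. (F) $R_N>0$ (positive definite) for all $N$.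 Idiosyncratic. A zero-mean random sequence $\mathbf z=(\mathbf z(k))_{k\ge1}$ with covariance $\Sigma$ is idiosyncratic if $\lim_{m\to\infty}a_m^\top\mathbf z=0$ in mean square for every sequence $(a_m)$ of elements of $\ell^2$ with $a_m^\top\Sigma a_m<\infty$ and $\|a_m\|_{\ell^2}\to0$; equivalently, the covariances of the truncations to the first $N$ components are bounded in operator norm uniformly in $N$. A family of $N$-dimensional random vectors is said to tend to an idiosyncratic process when its covariance matrices are bounded in operator norm uniformly in $N$. Given assumption (C) on $C$, a limit model with loading matrix $C$ is a legitimate DGFA model if and only if its limiting output noise is idiosyncratic. Kalman predictor. $\hat{\mathbf x}_N(t\mid t-1)$ is the best linear (minimum-variance) estimate of $\mathbf x(t)$ given the infinite past $\{\mathbf y_N(s):s\le t-1\}$. Its error covariance $P_N$ is the stabilizing solution of the algebraic Riccati equation $$P_N=A\big[P_N-P_NC_N^\top(C_NP_NC_N^\top+R_N)^{-1}C_NP_N\big]A^\top+Q,$$ and $\Lambda_N=C_NP_NC_N^\top+R_N$, $K_N=AP_NC_N^\top\Lambda_N^{-1}$. *)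

theory Defs
  imports
    "HOL-Probability.Probability"
    "Jordan_Normal_Form.Spectral_Radius"
    "Jordan_Normal_Form.DL_Rank"
    "Jordan_Normal_Form.Gauss_Jordan_Elimination"
begin

text \<open>
  Vectors and matrices are those of \<^theory>\<open>Jordan_Normal_Form.Matrix\<close>, since the output
  dimension \<open>N\<close> varies. A scalar sequence of random variables has type \<open>nat \<Rightarrow> 'a \<Rightarrow> real\<close>
  (components numbered from 0), a process has type \<open>int \<Rightarrow> nat \<Rightarrow> 'a \<Rightarrow> real\<close> (time first);
  a \<open>d\<close>-dimensional vector or process is given by its components with index below \<open>d\<close>.
  A matrix with countably many rows is a function \<open>nat \<Rightarrow> nat \<Rightarrow> real\<close>.
\<close>

section \<open>Vectors and matrices\<close>

definition first :: "nat \<Rightarrow> (nat \<Rightarrow> 'a \<Rightarrow> real) \<Rightarrow> 'a \<Rightarrow> real Matrix.vec" where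
  "first N z \<omega> = Matrix.vec N (\<lambda>k. z k \<omega>)"

definition first_rows :: "nat \<Rightarrow> nat \<Rightarrow> (nat \<Rightarrow> nat \<Rightarrow> real) \<Rightarrow> real Matrix.mat" where
  "first_rows n N C = Matrix.mat N n (\<lambda>(i, j). C i j)"

definition spectral_norm :: "real Matrix.mat \<Rightarrow> real" where
  "spectral_norm B =
     Sup {sqrt (scalar_prod (B *\<^sub>v u) (B *\<^sub>v u)) | u.
            u \<in> carrier_vec (dim_col B) \<and> scalar_prod u u \<le> 1}"

definition pos_def :: "real Matrix.mat \<Rightarrow> bool" where
  "pos_def B \<longleftrightarrow>
     (\<forall>u \<in> carrier_vec (dim_row B). u \<noteq> 0\<^sub>v (dim_row B) \<longrightarrow> scalar_prod u (B *\<^sub>v u) > 0)"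

text \<open>Only meaningful when the eigenvalues are real, e.g. for symmetric matrices.\<close>

definition lambda_min :: "real Matrix.mat \<Rightarrow> real" where
  "lambda_min B = Min (spectrum B)"

definition asymptotically_stable :: "real Matrix.mat \<Rightarrow> bool" where
  "asymptotically_stable A \<longleftrightarrow>
     (\<forall>z. eigenvalue (map_mat complex_of_real A) z \<longrightarrow> cmod z < 1)"

text \<open>The block matrix \<open>[Q, A Q, \<dots>, A\<^sup>n\<^sup>-\<^sup>1 Q]\<close>.\<close>

definition reachability_matrix :: "nat \<Rightarrow> real Matrix.mat \<Rightarrow> real Matrix.mat \<Rightarrow> real Matrix.mat" where
  "reachability_matrix n A Q =
     Matrix.mat n (n * n) (\<lambda>(i, j). ((A ^\<^sub>m (j div n)) * Q) $$ (i, j mod n))"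

definition reachable :: "nat \<Rightarrow> real Matrix.mat \<Rightarrow> real Matrix.mat \<Rightarrow> bool" where
  "reachable n A Q \<longleftrightarrow> vec_space.rank n (reachability_matrix n A Q) = n"

definition observable :: "nat \<Rightarrow> real Matrix.mat \<Rightarrow> (nat \<Rightarrow> nat \<Rightarrow> real) \<Rightarrow> bool" where
  "observable n A C \<longleftrightarrow>
     (\<forall>u \<in> carrier_vec n.
        (\<forall>N k. first_rows n N C *\<^sub>v ((A ^\<^sub>m k) *\<^sub>v u) = 0\<^sub>v N) \<longrightarrow> u = 0\<^sub>v n)"

definition minimal_realization ::
  "nat \<Rightarrow> real Matrix.mat \<Rightarrow> real Matrix.mat \<Rightarrow> (nat \<Rightarrow> nat \<Rightarrow> real) \<Rightarrow> bool" where
  "minimal_realization n A Q C \<longleftrightarrow> reachable n A Q \<and> observable n A C"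

definition strongly_lin_indep :: "nat \<Rightarrow> (nat \<Rightarrow> nat \<Rightarrow> real) \<Rightarrow> bool" where
  "strongly_lin_indep n C \<longleftrightarrow>
     filterlim (\<lambda>N. lambda_min (transpose_mat (first_rows n N C) * first_rows n N C))
       at_top sequentially"

section \<open>Second-order random variables and processes\<close>

definition square_integrable :: "'a measure \<Rightarrow> ('a \<Rightarrow> real) \<Rightarrow> bool" where
  "square_integrable M X \<longleftrightarrow> X \<in> borel_measurable M \<and> integrable M (\<lambda>\<omega>. (X \<omega>)\<^sup>2)"

definition zero_mean_L2 :: "'a measure \<Rightarrow> ('a \<Rightarrow> real) \<Rightarrow> bool" where
  "zero_mean_L2 M X \<longleftrightarrow> square_integrable M X \<and> integral\<^sup>L M X = 0"

text \<open>Covariances are written without centering, as all variables have mean zero.\<close>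

definition covar :: "'a measure \<Rightarrow> ('a \<Rightarrow> real) \<Rightarrow> ('a \<Rightarrow> real) \<Rightarrow> real" where
  "covar M X Y = (\<integral>\<omega>. X \<omega> * Y \<omega> \<partial>M)"

definition cov_mat :: "'a measure \<Rightarrow> nat \<Rightarrow> (nat \<Rightarrow> 'a \<Rightarrow> real) \<Rightarrow> real Matrix.mat" where
  "cov_mat M N z = Matrix.mat N N (\<lambda>(i, j). covar M (z i) (z j))"

definition ms_tendsto :: "'a measure \<Rightarrow> (nat \<Rightarrow> 'a \<Rightarrow> real) \<Rightarrow> ('a \<Rightarrow> real) \<Rightarrow> bool" where
  "ms_tendsto M X Z \<longleftrightarrow> (\<lambda>k. \<integral>\<omega>. (X k \<omega> - Z \<omega>)\<^sup>2 \<partial>M) \<longlonglongrightarrow> 0"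

definition wide_sense_stationary :: "'a measure \<Rightarrow> 'i set \<Rightarrow> (int \<Rightarrow> 'i \<Rightarrow> 'a \<Rightarrow> real) \<Rightarrow> bool" where
  "wide_sense_stationary M I z \<longleftrightarrow>
     (\<forall>i\<in>I. \<forall>j\<in>I. \<forall>s t h. covar M (z (s + h) i) (z (t + h) j) = covar M (z s i) (z t j))"

definition white_noise :: "'a measure \<Rightarrow> 'i set \<Rightarrow> (int \<Rightarrow> 'i \<Rightarrow> 'a \<Rightarrow> real) \<Rightarrow> bool" where
  "white_noise M I z \<longleftrightarrow>
     wide_sense_stationary M I z \<and>
     (\<forall>i\<in>I. \<forall>j\<in>I. \<forall>s t. s \<noteq> t \<longrightarrow> covar M (z s i) (z t j) = 0)"

text \<open>
  For \<open>a \<in> \<ell>\<^sup>2\<close> the condition that \<open>a\<^sup>T \<Sigma> a\<close> be finite is read as: the partial sums of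
  \<open>a\<^sup>T z\<close> converge in mean square, to a variable \<open>Z\<close> (which then has variance \<open>a\<^sup>T \<Sigma> a\<close>).
\<close>

definition idiosyncratic :: "'a measure \<Rightarrow> (nat \<Rightarrow> 'a \<Rightarrow> real) \<Rightarrow> bool" where
  "idiosyncratic M z \<longleftrightarrow>
     (\<forall>(a :: nat \<Rightarrow> nat \<Rightarrow> real) Z.
        (\<forall>m. summable (\<lambda>k. (a m k)\<^sup>2)) \<longrightarrow>
        (\<forall>m. square_integrable M (Z m)) \<longrightarrow>
        (\<forall>m. ms_tendsto M (\<lambda>K \<omega>. \<Sum>k<K. a m k * z k \<omega>) (Z m)) \<longrightarrow>
        (\<lambda>m. sqrt (\<Sum>k. (a m k)\<^sup>2)) \<longlonglongrightarrow> 0 \<longrightarrow>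
        ms_tendsto M Z (\<lambda>_. 0))"

text \<open>\<open>e N\<close> is regarded as an \<open>N\<close>-dimensional vector; dimensions start at 1.\<close>

definition tends_to_idiosyncratic :: "'a measure \<Rightarrow> (nat \<Rightarrow> nat \<Rightarrow> 'a \<Rightarrow> real) \<Rightarrow> bool" where
  "tends_to_idiosyncratic M e \<longleftrightarrow>
     (\<exists>B. \<forall>N\<ge>1. spectral_norm (cov_mat M N (e N)) \<le> B)"

text \<open>
  For models with loading matrices \<open>C\<^sub>N\<close> and output noises \<open>e N t\<close>: the limit is a legitimate
  DGFA model if the loadings are strongly linearly independent and the output noise is
  idiosyncratic in the limit.
\<close>

definition tends_to_legitimate_DGFA ::
  "'a measure \<Rightarrow> nat \<Rightarrow> (nat \<Rightarrow> nat \<Rightarrow> real) \<Rightarrow> (nat \<Rightarrow> int \<Rightarrow> nat \<Rightarrow> 'a \<Rightarrow> real) \<Rightarrow> bool" where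
  "tends_to_legitimate_DGFA M n C e \<longleftrightarrow>
     strongly_lin_indep n C \<and> (\<forall>t. tends_to_idiosyncratic M (\<lambda>N. e N t))"

section \<open>Linear prediction\<close>

definition lin_combs :: "('a \<Rightarrow> real) set \<Rightarrow> ('a \<Rightarrow> real) set" where
  "lin_combs F = {\<lambda>\<omega>. \<Sum>f\<in>S. c f * f \<omega> | S c. finite S \<and> S \<subseteq> F}"

definition closed_lin_span :: "'a measure \<Rightarrow> ('a \<Rightarrow> real) set \<Rightarrow> ('a \<Rightarrow> real) set" where
  "closed_lin_span M F =
     {Z. square_integrable M Z \<and> (\<exists>X. (\<forall>k. X k \<in> lin_combs F) \<and> ms_tendsto M X Z)}"

definition best_linear_estimate ::
  "'a measure \<Rightarrow> ('a \<Rightarrow> real) set \<Rightarrow> ('a \<Rightarrow> real) \<Rightarrow> ('a \<Rightarrow> real) \<Rightarrow> bool" where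
  "best_linear_estimate M F X Z \<longleftrightarrow>
     Z \<in> closed_lin_span M F \<and>
     (\<forall>Z' \<in> closed_lin_span M F. (\<integral>\<omega>. (X \<omega> - Z \<omega>)\<^sup>2 \<partial>M) \<le> (\<integral>\<omega>. (X \<omega> - Z' \<omega>)\<^sup>2 \<partial>M))"

definition strict_past :: "nat \<Rightarrow> (int \<Rightarrow> nat \<Rightarrow> 'a \<Rightarrow> real) \<Rightarrow> int \<Rightarrow> ('a \<Rightarrow> real) set" where
  "strict_past N y t = {y s k | s k. s \<le> t - 1 \<and> k < N}"

text \<open>\<open>xh t\<close> is (a version of) the predictor of \<open>x t\<close> given the first \<open>N\<close> outputs up to \<open>t - 1\<close>.\<close>

definition kalman_predictor ::
  "'a measure \<Rightarrow> nat \<Rightarrow> nat \<Rightarrow> (int \<Rightarrow> nat \<Rightarrow> 'a \<Rightarrow> real) \<Rightarrow> (int \<Rightarrow> nat \<Rightarrow> 'a \<Rightarrow> real) \<Rightarrow>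
   (int \<Rightarrow> nat \<Rightarrow> 'a \<Rightarrow> real) \<Rightarrow> bool" where
  "kalman_predictor M n N x y xh \<longleftrightarrow>
     (\<forall>t. \<forall>i<n. best_linear_estimate M (strict_past N y t) (x t i) (xh t i))"

text \<open>Component \<open>k\<close> of \<open>y\<^sub>N(t) - C\<^sub>N xh(t)\<close>; relevant for \<open>k < N\<close>.\<close>

definition innovation ::
  "nat \<Rightarrow> (nat \<Rightarrow> nat \<Rightarrow> real) \<Rightarrow> (int \<Rightarrow> nat \<Rightarrow> 'a \<Rightarrow> real) \<Rightarrow> (int \<Rightarrow> nat \<Rightarrow> 'a \<Rightarrow> real) \<Rightarrow>
   int \<Rightarrow> nat \<Rightarrow> 'a \<Rightarrow> real" where
  "innovation n C y xh t k \<omega> = y t k \<omega> - (\<Sum>j<n. C k j * xh t j \<omega>)"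

definition kalman_gain ::
  "nat \<Rightarrow> nat \<Rightarrow> real Matrix.mat \<Rightarrow> (nat \<Rightarrow> nat \<Rightarrow> real) \<Rightarrow> real Matrix.mat \<Rightarrow> real Matrix.mat \<Rightarrow>
   real Matrix.mat" where
  "kalman_gain n N A C P \<Lambda> = A * P * transpose_mat (first_rows n N C) * the (mat_inverse \<Lambda>)"

definition innovation_representation ::
  "'a measure \<Rightarrow> nat \<Rightarrow> nat \<Rightarrow> real Matrix.mat \<Rightarrow> (nat \<Rightarrow> nat \<Rightarrow> real) \<Rightarrow> real Matrix.mat \<Rightarrow>
   (int \<Rightarrow> nat \<Rightarrow> 'a \<Rightarrow> real) \<Rightarrow> (int \<Rightarrow> nat \<Rightarrow> 'a \<Rightarrow> real) \<Rightarrow> (int \<Rightarrow> nat \<Rightarrow> 'a \<Rightarrow> real) \<Rightarrow> bool" where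
  "innovation_representation M n N A C K xh y e \<longleftrightarrow>
     (\<forall>t. AE \<omega> in M.
        first n (xh (t + 1)) \<omega> = A *\<^sub>v first n (xh t) \<omega> + K *\<^sub>v first N (e t) \<omega> \<and>
        first N (y t) \<omega> = first_rows n N C *\<^sub>v first n (xh t) \<omega> + first N (e t) \<omega>)"

section \<open>The model\<close>

text \<open>
  The output equation is stated for every component, hence for every truncation.
  The joint process \<open>(x, y)\<close> is indexed by the disjoint sum of the two index sets.
\<close>

locale dgfa_model = prob_space M
  for M :: "'a measure" +
  fixes n :: nat
    and A Q :: "real Matrix.mat"
    and C :: "nat \<Rightarrow> nat \<Rightarrow> real"
    and x v y w :: "int \<Rightarrow> nat \<Rightarrow> 'a \<Rightarrow> real"
  assumes n_pos: "n \<ge> 1"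
    and A_carrier: "A \<in> carrier_mat n n"
    and L2_x: "\<And>t i. i < n \<Longrightarrow> zero_mean_L2 M (x t i)"
    and L2_v: "\<And>t i. i < n \<Longrightarrow> zero_mean_L2 M (v t i)"
    and L2_y: "\<And>t k. zero_mean_L2 M (y t k)"
    and L2_w: "\<And>t k. zero_mean_L2 M (w t k)"
    and state_eq: "\<And>t. AE \<omega> in M. first n (x (t + 1)) \<omega> = A *\<^sub>v first n (x t) \<omega> + first n (v t) \<omega>"
    and output_eq: "\<And>t k. AE \<omega> in M. y t k \<omega> = (\<Sum>j<n. C k j * x t j \<omega>) + w t k \<omega>"
    and stable: "asymptotically_stable A"
    and white_v: "white_noise M {..<n} v"
    and cov_v: "\<And>t. cov_mat M n (v t) = Q"
    and white_w: "white_noise M UNIV w"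
    and uncorrelated: "\<And>s t i k. i < n \<Longrightarrow> covar M (v s i) (w t k) = 0"
    and loadings: "strongly_lin_indep n C"
    and idiosyncratic_w: "idiosyncratic M (w 0)"
    and stationary: "wide_sense_stationary M ({..<n} <+> UNIV) (\<lambda>t. case_sum (x t) (y t))"
    and minimal: "minimal_realization n A Q C"
    and R_pos_def: "\<And>N. N \<ge> 1 \<Longrightarrow> pos_def (cov_mat M N (w 0))"

end

theory Submission
  imports Defs
begin

text \<open>
  The innovation is \<open>e\<^sub>N = C\<^sub>N (x - xh) + w\<^sub>N\<close> with uncorrelated summands, so
  \<open>\<Lambda>\<^sub>N = C\<^sub>N P\<^sub>N C\<^sub>N\<^sup>T + R\<^sub>N\<close>. The input \<open>v(t)\<close> is uncorrelated with all outputs up to time \<open>t\<close>,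
  hence \<open>P\<^sub>N \<ge> Q\<close> however many outputs are observed, and by reachability some diagonal entry
  \<open>Q\<^sub>i\<^sub>i\<close> is positive. If \<open>z\<close> solves \<open>C\<^sub>N\<^sup>T C\<^sub>N z = e\<^sub>i\<close> (\<open>i\<close>-th unit vector) and \<open>a = C\<^sub>N z\<close>, then
  \<open>a\<^sup>T \<Lambda>\<^sub>N a \<ge> Q\<^sub>i\<^sub>i\<close> while \<open>a\<^sup>T a \<le> 1 / \<lambda>\<close> for \<open>\<lambda>\<close> the smallest eigenvalue of \<open>C\<^sub>N\<^sup>T C\<^sub>N\<close>. Thus the
  norm of \<open>\<Lambda>\<^sub>N\<close> is at least \<open>\<lambda> Q\<^sub>i\<^sub>i\<close>, which is unbounded by strong linear independence.
\<close>

unbundle no inner_syntax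
unbundle no vec_syntax

section \<open>Square-integrable variables\<close>

text \<open>Three facts that look given have to be proved. Causality: the model only says that
  \<open>x\<close> is stationary and solves the state equation, so the orthogonality of the noises
  to the past is obtained from stability, by iterating that equation backwards. Steady state: the
  predictor is specified separately at each time and up to null sets, so the time invariance of its
  error covariance \<open>P\<close> comes from the joint stationarity of \<open>x\<close> and
  \<open>y\<close>; \<open>P\<close> is this covariance itself, without a detour through the Riccati
  equation. Recursion: the right-hand side of the innovation representation is identified with the
  next predictor by its orthogonality property. On the algebraic side, \<open>lambda_min\<close> is
  a minimum over the spectrum and has to be linked to Rayleigh quotients. The vector
  \<open>z\<close> is available once that eigenvalue is positive, thus for all large
  \<open>N\<close>, which is enough for unboundedness.\<close>

lemma square_integrable_mult:
  assumes "square_integrable M X" "square_integrable M Y"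
  shows "integrable M (\<lambda>\<omega>. X \<omega> * Y \<omega>)"
proof (rule Bochner_Integration.integrable_bound)
  show "integrable M (\<lambda>\<omega>. (X \<omega>)\<^sup>2 + (Y \<omega>)\<^sup>2)"
    using assms by (auto simp: square_integrable_def)
  show "(\<lambda>\<omega>. X \<omega> * Y \<omega>) \<in> borel_measurable M"
    using assms by (auto simp: square_integrable_def)
  have "\<bar>a * b\<bar> \<le> a\<^sup>2 + b\<^sup>2" for a b :: real
    using sum_squares_bound[of "\<bar>a\<bar>" "\<bar>b\<bar>"] mult_nonneg_nonneg[of "\<bar>a\<bar>" "\<bar>b\<bar>"]
    unfolding abs_mult power2_abs by linarith
  then show "AE \<omega> in M. norm (X \<omega> * Y \<omega>) \<le> norm ((X \<omega>)\<^sup>2 + (Y \<omega>)\<^sup>2)"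
    by (intro AE_I2) (simp add: abs_of_nonneg)
qed

lemma square_integrable_scale [intro]:
  "square_integrable M X \<Longrightarrow> square_integrable M (\<lambda>\<omega>. c * X \<omega>)"
  by (auto simp: square_integrable_def power_mult_distrib)

lemma square_integrable_add [intro]:
  assumes "square_integrable M X" "square_integrable M Y"
  shows "square_integrable M (\<lambda>\<omega>. X \<omega> + Y \<omega>)"
  using assms square_integrable_mult[OF assms]
  by (auto simp: square_integrable_def power2_sum mult.assoc)

lemma square_integrable_diff [intro]:
  assumes "square_integrable M X" "square_integrable M Y"
  shows "square_integrable M (\<lambda>\<omega>. X \<omega> - Y \<omega>)"
  using assms square_integrable_mult[OF assms]
  by (auto simp: square_integrable_def power2_diff mult.assoc)

lemma square_integrable_sum [intro]:
  "\<forall>i\<in>I. square_integrable M (X i) \<Longrightarrow> square_integrable M (\<lambda>\<omega>. \<Sum>i\<in>I. X i \<omega>)"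
  by (induction I rule: infinite_finite_induct) (auto simp: square_integrable_def[of _ "\<lambda>_. 0"])

lemma covar_commute: "covar M X Y = covar M Y X"
  by (simp add: covar_def mult.commute)

lemma covar_scale_left: "covar M (\<lambda>\<omega>. c * X \<omega>) Y = c * covar M X Y"
  by (simp add: covar_def mult.assoc)

lemma covar_scale_right: "covar M Y (\<lambda>\<omega>. c * X \<omega>) = c * covar M Y X"
  by (simp add: covar_def mult.left_commute)

lemma covar_add_left:
  "square_integrable M X \<Longrightarrow> square_integrable M Y \<Longrightarrow> square_integrable M Z \<Longrightarrow>
   covar M (\<lambda>\<omega>. X \<omega> + Y \<omega>) Z = covar M X Z + covar M Y Z"
  unfolding covar_def distrib_right by (simp add: square_integrable_mult)

lemma covar_diff_left:
  "square_integrable M X \<Longrightarrow> square_integrable M Y \<Longrightarrow> square_integrable M Z \<Longrightarrow>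
   covar M (\<lambda>\<omega>. X \<omega> - Y \<omega>) Z = covar M X Z - covar M Y Z"
  unfolding covar_def left_diff_distrib by (simp add: square_integrable_mult)

lemma covar_sum_left:
  "\<forall>i\<in>I. square_integrable M (X i) \<Longrightarrow> square_integrable M Z \<Longrightarrow>
   covar M (\<lambda>\<omega>. \<Sum>i\<in>I. X i \<omega>) Z = (\<Sum>i\<in>I. covar M (X i) Z)"
  unfolding covar_def sum_distrib_right by (simp add: square_integrable_mult)

lemma covar_add_right:
  "square_integrable M X \<Longrightarrow> square_integrable M Y \<Longrightarrow> square_integrable M Z \<Longrightarrow>
   covar M Z (\<lambda>\<omega>. X \<omega> + Y \<omega>) = covar M Z X + covar M Z Y"
  by (subst (1 2 3) covar_commute) (rule covar_add_left)

lemma covar_diff_right: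
  "square_integrable M X \<Longrightarrow> square_integrable M Y \<Longrightarrow> square_integrable M Z \<Longrightarrow>
   covar M Z (\<lambda>\<omega>. X \<omega> - Y \<omega>) = covar M Z X - covar M Z Y"
  by (subst (1 2 3) covar_commute) (rule covar_diff_left)

lemma covar_sum_right:
  "\<forall>i\<in>I. square_integrable M (X i) \<Longrightarrow> square_integrable M Z \<Longrightarrow>
   covar M Z (\<lambda>\<omega>. \<Sum>i\<in>I. X i \<omega>) = (\<Sum>i\<in>I. covar M Z (X i))"
  by (subst (1 2) covar_commute) (rule covar_sum_left)

lemma covar_cong_AE:
  assumes "square_integrable M X" "square_integrable M X'"
    and "square_integrable M Y" "square_integrable M Y'"
    and "AE \<omega> in M. X \<omega> = X' \<omega>" "AE \<omega> in M. Y \<omega> = Y' \<omega>"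
  shows "covar M X Y = covar M X' Y'"
  unfolding covar_def using assms
  by (intro integral_cong_AE) (auto simp: square_integrable_def)

lemma covar_self_nonneg [simp]: "covar M X X \<ge> 0"
  by (simp add: covar_def)

lemma covar_add_self:
  assumes "square_integrable M X" "square_integrable M Y"
  shows "covar M (\<lambda>\<omega>. X \<omega> + Y \<omega>) (\<lambda>\<omega>. X \<omega> + Y \<omega>)
    = covar M X X + 2 * covar M X Y + covar M Y Y"
  using assms
  by (simp add: covar_add_left covar_add_right square_integrable_add covar_commute[of M Y X])

lemma covar_diff_self:
  assumes "square_integrable M X" "square_integrable M Y"
  shows "covar M (\<lambda>\<omega>. X \<omega> - Y \<omega>) (\<lambda>\<omega>. X \<omega> - Y \<omega>)
    = covar M X X - 2 * covar M X Y + covar M Y Y"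
  using assms
  by (simp add: covar_diff_left covar_diff_right square_integrable_diff covar_commute[of M Y X])

text \<open>The discriminant condition for a quadratic in \<open>s\<close> that is never negative.
  It yields Cauchy-Schwarz for covariances and for semidefinite forms, and with \<open>a = 0\<close>
  the vanishing of a first-order term.\<close>

lemma quadratic_nonneg_imp:
  fixes a b c :: real
  assumes "\<And>s. a - 2 * s * b + s\<^sup>2 * c \<ge> 0" "c \<ge> 0"
  shows "b\<^sup>2 \<le> a * c"
proof (cases "c = 0")
  case True
  have "b = 0"
  proof (rule ccontr)
    assume "b \<noteq> 0"
    \<comment> \<open>The quadratic degenerates to a line of nonzero slope, and this
      \<open>s\<close> gives it the value -1.\<close>
    then show False using assms(1)[of "(a + 1) / (2 * b)"] True by (simp add: field_simps)
  qed
  then show ?thesis using True by simp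
next
  case False
  then show ?thesis using assms(1)[of "b / c"] assms(2)
    by (simp add: field_simps power2_eq_square)
qed

lemma covar_Cauchy_Schwarz:
  assumes "square_integrable M X" "square_integrable M Y"
  shows "(covar M X Y)\<^sup>2 \<le> covar M X X * covar M Y Y"
proof (rule quadratic_nonneg_imp)
  fix s
  have "0 \<le> covar M (\<lambda>\<omega>. X \<omega> - s * Y \<omega>) (\<lambda>\<omega>. X \<omega> - s * Y \<omega>)" by simp
  also have "\<dots> = covar M X X - 2 * s * covar M X Y + s\<^sup>2 * covar M Y Y"
    using assms by (subst covar_diff_self)
      (auto simp: covar_scale_left covar_scale_right power2_eq_square)
  finally show "0 \<le> covar M X X - 2 * s * covar M X Y + s\<^sup>2 * covar M Y Y" .
qed simp

lemma covar_self_eq_0_imp: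
  assumes "square_integrable M X" "covar M X X = 0"
  shows "AE \<omega> in M. X \<omega> = 0"
proof -
  have "integrable M (\<lambda>\<omega>. X \<omega> * X \<omega>)" using assms(1) by (simp add: square_integrable_mult)
  from integral_nonneg_eq_0_iff_AE[OF this] assms(2) show ?thesis by (simp add: covar_def)
qed

lemma ms_tendsto_covar:
  "ms_tendsto M X Z \<longleftrightarrow>
     (\<lambda>k. covar M (\<lambda>\<omega>. X k \<omega> - Z \<omega>) (\<lambda>\<omega>. X k \<omega> - Z \<omega>)) \<longlonglongrightarrow> 0"
  by (simp add: ms_tendsto_def covar_def power2_eq_square)

text \<open>Cauchy-Schwarz bounds the squared covariance of \<open>V\<close> with
  \<open>X k - Z\<close> by a constant times the mean-square distance.\<close>

lemma ms_tendsto_covar_right: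
  assumes lim: "ms_tendsto M X Z" and X: "\<And>k. square_integrable M (X k)"
    and Z: "square_integrable M Z" and V: "square_integrable M V"
  shows "(\<lambda>k. covar M V (X k)) \<longlonglongrightarrow> covar M V Z"
proof -
  have "(\<lambda>k. (covar M V (\<lambda>\<omega>. X k \<omega> - Z \<omega>))\<^sup>2) \<longlonglongrightarrow> 0"
  proof (rule tendsto_sandwich[OF _ _ tendsto_const])
    show "\<forall>\<^sub>F k in sequentially. (covar M V (\<lambda>\<omega>. X k \<omega> - Z \<omega>))\<^sup>2 \<le>
      covar M V V * covar M (\<lambda>\<omega>. X k \<omega> - Z \<omega>) (\<lambda>\<omega>. X k \<omega> - Z \<omega>)"
      using X Z V by (intro always_eventually allI covar_Cauchy_Schwarz) auto
    show "(\<lambda>k. covar M V V * covar M (\<lambda>\<omega>. X k \<omega> - Z \<omega>) (\<lambda>\<omega>. X k \<omega> - Z \<omega>)) \<longlonglongrightarrow> 0"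
      using tendsto_mult_right_zero[OF lim[unfolded ms_tendsto_covar]] .
  qed simp
  then have "(\<lambda>k. covar M V (\<lambda>\<omega>. X k \<omega> - Z \<omega>)) \<longlonglongrightarrow> 0"
    by (simp add: tendsto_null_power)
  then have "(\<lambda>k. covar M V (X k) - covar M V Z) \<longlonglongrightarrow> 0"
    using X Z V by (simp add: covar_diff_right)
  then show ?thesis by (rule LIM_zero_cancel)
qed

section \<open>Linear prediction\<close>

lemma lin_combs_add:
  assumes "X \<in> lin_combs F" "Y \<in> lin_combs F"
  shows "(\<lambda>\<omega>. X \<omega> + Y \<omega>) \<in> lin_combs F"
proof -
  from assms obtain S c T d where *: "finite S" "S \<subseteq> F" "X = (\<lambda>\<omega>. \<Sum>f\<in>S. c f * f \<omega>)"
    "finite T" "T \<subseteq> F" "Y = (\<lambda>\<omega>. \<Sum>f\<in>T. d f * f \<omega>)"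
    by (auto simp: lin_combs_def)
  \<comment> \<open>The two supports may overlap, so both coefficient families are extended by zero
    to the union and added.\<close>
  let ?e = "\<lambda>f. (if f \<in> S then c f else 0) + (if f \<in> T then d f else 0)"
  have "(\<Sum>f\<in>S \<union> T. ?e f * f \<omega>) = X \<omega> + Y \<omega>" for \<omega>
  proof -
    have "(\<Sum>f\<in>S \<union> T. ?e f * f \<omega>) = (\<Sum>f\<in>S \<union> T. if f \<in> S then c f * f \<omega> else 0)
      + (\<Sum>f\<in>S \<union> T. if f \<in> T then d f * f \<omega> else 0)"
      by (simp add: distrib_right sum.distrib if_distrib[of "\<lambda>x. x * _"] cong: if_cong)
    also have "\<dots> = X \<omega> + Y \<omega>"
      using *(1,4) by (simp add: *(3,6) sum.If_cases Int_absorb1)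
    finally show ?thesis .
  qed
  then have "(\<lambda>\<omega>. X \<omega> + Y \<omega>) = (\<lambda>\<omega>. \<Sum>f\<in>S \<union> T. ?e f * f \<omega>)" by presburger
  then show ?thesis unfolding lin_combs_def using *(1,2,4,5)
    by (intro CollectI exI[of _ "S \<union> T"] exI[of _ ?e]) simp
qed

lemma lin_combs_scale:
  assumes "X \<in> lin_combs F"
  shows "(\<lambda>\<omega>. b * X \<omega>) \<in> lin_combs F"
proof -
  from assms obtain S c where *: "finite S" "S \<subseteq> F" "X = (\<lambda>\<omega>. \<Sum>f\<in>S. c f * f \<omega>)"
    by (auto simp: lin_combs_def)
  have "(\<lambda>\<omega>. b * X \<omega>) = (\<lambda>\<omega>. \<Sum>f\<in>S. (b * c f) * f \<omega>)"
    by (simp add: * sum_distrib_left mult.assoc)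
  with * show ?thesis unfolding lin_combs_def by (auto intro!: exI[of _ S])
qed

lemma lin_combs_incl: "f \<in> F \<Longrightarrow> f \<in> lin_combs F"
  unfolding lin_combs_def by (auto intro!: exI[of _ "{f}"] exI[of _ "\<lambda>_. 1"])

lemma lin_combs_sum:
  "finite I \<Longrightarrow> (\<And>i. i \<in> I \<Longrightarrow> X i \<in> lin_combs F) \<Longrightarrow> (\<lambda>\<omega>. \<Sum>i\<in>I. X i \<omega>) \<in> lin_combs F"
proof (induction I rule: finite_induct)
  case empty
  show ?case unfolding lin_combs_def by (auto intro!: exI[of _ "{}"])
next
  case (insert i I)
  then show ?case using lin_combs_add[of "X i" F "\<lambda>\<omega>. \<Sum>i\<in>I. X i \<omega>"] by auto
qed

text \<open>Written over an index set, a combination has coefficients that can be reused for another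
  family with the same indices: this is how combinations of past outputs are shifted in
  time.\<close>

lemma lin_combs_image:
  "lin_combs (g ` J) = {\<lambda>\<omega>. \<Sum>j\<in>I. c j * g j \<omega> | I c. finite I \<and> I \<subseteq> J}" (is "?L = ?R")
proof
  show "?R \<subseteq> ?L"
    by (safe, intro lin_combs_sum lin_combs_scale lin_combs_incl) auto
  show "?L \<subseteq> ?R"
  proof
    fix X assume "X \<in> ?L"
    then obtain S c where *: "finite S" "S \<subseteq> g ` J" "X = (\<lambda>\<omega>. \<Sum>f\<in>S. c f * f \<omega>)"
      by (auto simp: lin_combs_def)
    \<comment> \<open>Several indices may name the same function; one of them is kept for each
      member of \<open>S\<close>.\<close>
    from *(2) obtain I where I: "I \<subseteq> J" "inj_on g I" "S = g ` I"
      by (auto simp: subset_image_inj)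
    then have "finite I" using *(1) by (simp add: finite_image_iff)
    moreover have "X = (\<lambda>\<omega>. \<Sum>j\<in>I. c (g j) * g j \<omega>)"
      by (simp add: * I sum.reindex)
    ultimately show "X \<in> ?R" using I(1)
      by (intro CollectI exI[of _ I] exI[of _ "\<lambda>j. c (g j)"]) simp
  qed
qed

lemma lin_combs_square_integrable:
  "(\<And>f. f \<in> F \<Longrightarrow> square_integrable M f) \<Longrightarrow> X \<in> lin_combs F \<Longrightarrow> square_integrable M X"
  by (auto simp: lin_combs_def intro!: square_integrable_sum square_integrable_scale)

lemma lin_combs_mono: "F \<subseteq> G \<Longrightarrow> lin_combs F \<subseteq> lin_combs G"
  unfolding lin_combs_def by blast

lemma closed_lin_span_mono: "F \<subseteq> G \<Longrightarrow> closed_lin_span M F \<subseteq> closed_lin_span M G"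
  unfolding closed_lin_span_def using lin_combs_mono[of F G] by blast

lemma closed_lin_span_square_integrable: "Z \<in> closed_lin_span M F \<Longrightarrow> square_integrable M Z"
  by (simp add: closed_lin_span_def)

lemma lin_combs_closed_lin_span:
  assumes "\<And>f. f \<in> F \<Longrightarrow> square_integrable M f"
  shows "lin_combs F \<subseteq> closed_lin_span M F"
proof
  fix X assume X: "X \<in> lin_combs F"
  then have "square_integrable M X" using assms lin_combs_square_integrable by blast
  moreover have "ms_tendsto M (\<lambda>_. X) X" by (simp add: ms_tendsto_def)
  ultimately show "X \<in> closed_lin_span M F"
    using X by (auto simp: closed_lin_span_def intro!: exI[of _ "\<lambda>_. X"])
qed

lemma closed_lin_span_incl:
  "(\<And>f. f \<in> F \<Longrightarrow> square_integrable M f) \<Longrightarrow> f \<in> F \<Longrightarrow> f \<in> closed_lin_span M F"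
  using lin_combs_closed_lin_span[of F M] lin_combs_incl[of f F] by blast

lemma closed_lin_span_add:
  assumes F: "\<And>f. f \<in> F \<Longrightarrow> square_integrable M f"
    and "Y \<in> closed_lin_span M F" "Z \<in> closed_lin_span M F"
  shows "(\<lambda>\<omega>. Y \<omega> + Z \<omega>) \<in> closed_lin_span M F"
proof -
  from assms obtain S T where *: "\<And>k. S k \<in> lin_combs F" "ms_tendsto M S Y"
    "\<And>k. T k \<in> lin_combs F" "ms_tendsto M T Z" "square_integrable M Y" "square_integrable M Z"
    by (auto simp: closed_lin_span_def)
  have ST: "square_integrable M (S k)" "square_integrable M (T k)" for k
    using * F lin_combs_square_integrable by blast+
  let ?D = "\<lambda>k \<omega>. S k \<omega> - Y \<omega>" and ?E = "\<lambda>k \<omega>. T k \<omega> - Z \<omega>"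
  have "ms_tendsto M (\<lambda>k \<omega>. S k \<omega> + T k \<omega>) (\<lambda>\<omega>. Y \<omega> + Z \<omega>)"
    unfolding ms_tendsto_covar
  proof (rule tendsto_sandwich[OF _ _ tendsto_const])
    show "\<forall>\<^sub>F k in sequentially. covar M (\<lambda>\<omega>. S k \<omega> + T k \<omega> - (Y \<omega> + Z \<omega>))
        (\<lambda>\<omega>. S k \<omega> + T k \<omega> - (Y \<omega> + Z \<omega>))
      \<le> 2 * covar M (?D k) (?D k) + 2 * covar M (?E k) (?E k)"
    proof (intro always_eventually allI)
      fix k
      have D: "square_integrable M (?D k)" "square_integrable M (?E k)" using ST * by auto
      have "covar M (\<lambda>\<omega>. S k \<omega> + T k \<omega> - (Y \<omega> + Z \<omega>)) (\<lambda>\<omega>. S k \<omega> + T k \<omega> - (Y \<omega> + Z \<omega>))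
        = covar M (\<lambda>\<omega>. ?D k \<omega> + ?E k \<omega>) (\<lambda>\<omega>. ?D k \<omega> + ?E k \<omega>)"
        by (simp add: algebra_simps)
      \<comment> \<open>Adding this nonnegative term to the variance of the sum cancels the cross
        term and doubles both variances.\<close>
      moreover have "0 \<le> covar M (\<lambda>\<omega>. ?D k \<omega> - ?E k \<omega>) (\<lambda>\<omega>. ?D k \<omega> - ?E k \<omega>)" by simp
      ultimately show "covar M (\<lambda>\<omega>. S k \<omega> + T k \<omega> - (Y \<omega> + Z \<omega>))
          (\<lambda>\<omega>. S k \<omega> + T k \<omega> - (Y \<omega> + Z \<omega>))
        \<le> 2 * covar M (?D k) (?D k) + 2 * covar M (?E k) (?E k)"
        unfolding covar_diff_self[OF D] covar_add_self[OF D] by linarith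
    qed
    show "(\<lambda>k. 2 * covar M (?D k) (?D k) + 2 * covar M (?E k) (?E k)) \<longlonglongrightarrow> 0"
      using *(2,4) unfolding ms_tendsto_covar
      by (auto intro!: tendsto_eq_intros)
  qed simp
  then show ?thesis unfolding closed_lin_span_def using *
    by (auto intro!: exI[of _ "\<lambda>k \<omega>. S k \<omega> + T k \<omega>"] lin_combs_add)
qed

lemma closed_lin_span_scale:
  assumes "Y \<in> closed_lin_span M F"
  shows "(\<lambda>\<omega>. b * Y \<omega>) \<in> closed_lin_span M F"
proof -
  from assms obtain S where *: "\<And>k. S k \<in> lin_combs F" "ms_tendsto M S Y" "square_integrable M Y"
    by (auto simp: closed_lin_span_def)
  have "ms_tendsto M (\<lambda>k \<omega>. b * S k \<omega>) (\<lambda>\<omega>. b * Y \<omega>)"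
    using tendsto_mult_right_zero[OF *(2)[unfolded ms_tendsto_def], of "b\<^sup>2"] unfolding ms_tendsto_def
    by (simp add: right_diff_distrib[symmetric] power_mult_distrib)
  then show ?thesis unfolding closed_lin_span_def using *
    by (auto intro!: exI[of _ "\<lambda>k \<omega>. b * S k \<omega>"] lin_combs_scale)
qed

lemma closed_lin_span_diff:
  assumes F: "\<And>f. f \<in> F \<Longrightarrow> square_integrable M f"
    and "Y \<in> closed_lin_span M F" "Z \<in> closed_lin_span M F"
  shows "(\<lambda>\<omega>. Y \<omega> - Z \<omega>) \<in> closed_lin_span M F"
  using closed_lin_span_add[OF F assms(2) closed_lin_span_scale[OF assms(3), of "-1"]] by simp

lemma closed_lin_span_sum:
  assumes F: "\<And>f. f \<in> F \<Longrightarrow> square_integrable M f"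
  shows "finite I \<Longrightarrow> (\<And>i. i \<in> I \<Longrightarrow> X i \<in> closed_lin_span M F) \<Longrightarrow>
    (\<lambda>\<omega>. \<Sum>i\<in>I. X i \<omega>) \<in> closed_lin_span M F"
proof (induction I rule: finite_induct)
  case empty
  have "(\<lambda>\<omega>. 0) \<in> lin_combs F" using lin_combs_sum[of "{}"] by simp
  then show ?case using lin_combs_closed_lin_span[OF F] by auto
next
  case (insert i I)
  then show ?case using closed_lin_span_add[OF F, where Y = "X i" and Z = "\<lambda>\<omega>. \<Sum>i\<in>I. X i \<omega>"] by auto
qed

text \<open>Linearity carries orthogonality from the generators to their combinations, and
  continuity of the covariance carries it to mean-square limits.\<close>

lemma closed_lin_span_orthogonal:
  assumes F: "\<And>f. f \<in> F \<Longrightarrow> square_integrable M f" and V: "square_integrable M V"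
    and orth: "\<And>f. f \<in> F \<Longrightarrow> covar M V f = 0" and Z: "Z \<in> closed_lin_span M F"
  shows "covar M V Z = 0"
proof -
  from Z obtain S where *: "\<And>k. S k \<in> lin_combs F" "ms_tendsto M S Z" "square_integrable M Z"
    by (auto simp: closed_lin_span_def)
  have "square_integrable M (S k)" for k
    using * F lin_combs_square_integrable by blast
  then have lim: "(\<lambda>k. covar M V (S k)) \<longlonglongrightarrow> covar M V Z"
    using * V by (intro ms_tendsto_covar_right)
  have "covar M V (S k) = 0" for k
  proof -
    from *(1)[of k] obtain I c where S: "finite I" "I \<subseteq> F" "S k = (\<lambda>\<omega>. \<Sum>f\<in>I. c f * f \<omega>)"
      by (auto simp: lin_combs_def)
    have "covar M V (S k) = (\<Sum>f\<in>I. covar M V (\<lambda>\<omega>. c f * f \<omega>))"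
      unfolding S(3) using S(2) F V by (intro covar_sum_right) auto
    also have "\<dots> = 0" using S(2) orth by (intro sum.neutral) (auto simp: covar_scale_right)
    finally show ?thesis .
  qed
  with lim show ?thesis by (simp add: LIMSEQ_const_iff)
qed

text \<open>Moving \<open>Z\<close> by \<open>s * Y\<close> cannot lower the error variance, so the
  change is a nonnegative quadratic in \<open>s\<close> without constant term, and its linear
  coefficient vanishes.\<close>

lemma best_linear_estimate_orthogonal:
  assumes F: "\<And>f. f \<in> F \<Longrightarrow> square_integrable M f" and X: "square_integrable M X"
    and best: "best_linear_estimate M F X Z" and Y: "Y \<in> closed_lin_span M F"
  shows "covar M (\<lambda>\<omega>. X \<omega> - Z \<omega>) Y = 0"
proof -
  let ?D = "\<lambda>\<omega>. X \<omega> - Z \<omega>"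
  have Z: "Z \<in> closed_lin_span M F" using best by (simp add: best_linear_estimate_def)
  have D: "square_integrable M ?D" and Y': "square_integrable M Y"
    using X Y Z closed_lin_span_square_integrable by blast+
  have "0 \<le> 0 - 2 * s * covar M ?D Y + s\<^sup>2 * covar M Y Y" for s
  proof -
    have "(\<lambda>\<omega>. Z \<omega> + s * Y \<omega>) \<in> closed_lin_span M F"
      using closed_lin_span_add[OF F Z closed_lin_span_scale[OF Y]] .
    then have "covar M ?D ?D \<le> (\<integral>\<omega>. (X \<omega> - (Z \<omega> + s * Y \<omega>))\<^sup>2 \<partial>M)"
      using best by (auto simp: best_linear_estimate_def covar_def power2_eq_square[symmetric])
    also have "\<dots> = covar M (\<lambda>\<omega>. ?D \<omega> - s * Y \<omega>) (\<lambda>\<omega>. ?D \<omega> - s * Y \<omega>)"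
      by (simp add: covar_def power2_eq_square diff_diff_eq)
    also have "\<dots> = covar M ?D ?D - 2 * s * covar M ?D Y + s\<^sup>2 * covar M Y Y"
      using D Y' by (subst covar_diff_self)
        (auto simp: covar_scale_left covar_scale_right power2_eq_square)
    finally show ?thesis by simp
  qed
  from quadratic_nonneg_imp[OF this] show ?thesis by simp
qed

text \<open>\<open>Z - Y\<close> lies in the span and is the difference of two residuals orthogonal
  to the span, so its variance is zero. This is the test by which a candidate is recognized as the
  predictor.\<close>

lemma best_linear_estimate_unique:
  assumes F: "\<And>f. f \<in> F \<Longrightarrow> square_integrable M f" and X: "square_integrable M X"
    and best: "best_linear_estimate M F X Z" and Y: "Y \<in> closed_lin_span M F"
    and orth: "\<And>f. f \<in> F \<Longrightarrow> covar M (\<lambda>\<omega>. X \<omega> - Y \<omega>) f = 0"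
  shows "AE \<omega> in M. Z \<omega> = Y \<omega>"
proof -
  have Z: "Z \<in> closed_lin_span M F" using best by (simp add: best_linear_estimate_def)
  note sq = closed_lin_span_square_integrable
  let ?D = "\<lambda>\<omega>. Z \<omega> - Y \<omega>"
  have D: "?D \<in> closed_lin_span M F" using closed_lin_span_diff[OF F Z Y] .
  have "covar M (\<lambda>\<omega>. X \<omega> - Y \<omega>) ?D = 0"
    using closed_lin_span_orthogonal[OF F _ orth D] X Y sq by blast
  moreover have "covar M (\<lambda>\<omega>. X \<omega> - Z \<omega>) ?D = 0"
    using best_linear_estimate_orthogonal[OF F X best D] .
  moreover have "covar M (\<lambda>\<omega>. (X \<omega> - Y \<omega>) - (X \<omega> - Z \<omega>)) ?D =
    covar M (\<lambda>\<omega>. X \<omega> - Y \<omega>) ?D - covar M (\<lambda>\<omega>. X \<omega> - Z \<omega>) ?D"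
    using X sq[OF Y] sq[OF Z] by (intro covar_diff_left) auto
  ultimately have "covar M ?D ?D = 0" by simp
  then show ?thesis using covar_self_eq_0_imp[OF sq[OF D]] by simp
qed

section \<open>Linear algebra\<close>

lemma mult_mat_vec_index_sum:
  assumes "B \<in> carrier_mat m n" "u \<in> carrier_vec n" "i < m"
  shows "(B *\<^sub>v u) $ i = (\<Sum>j<n. B $$ (i, j) * u $ j)"
  using assms by (simp add: scalar_prod_def lessThan_atLeast0)

lemma mult_mat_index_sum:
  assumes "B \<in> carrier_mat m p" "D \<in> carrier_mat p q" "i < m" "j < q"
  shows "(B * D) $$ (i, j) = (\<Sum>l<p. B $$ (i, l) * D $$ (l, j))"
  using assms by (simp add: scalar_prod_def lessThan_atLeast0)

lemma scalar_prod_self_nonneg: "0 \<le> u \<bullet> u" for u :: "real Matrix.vec"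
  by (simp add: scalar_prod_def sum_nonneg)

lemma scalar_prod_self_pos:
  fixes u :: "real Matrix.vec"
  assumes "u \<in> carrier_vec n" "u \<noteq> 0\<^sub>v n"
  shows "0 < u \<bullet> u"
proof -
  obtain i where i: "i < n" "u $ i \<noteq> 0"
    using assms eq_vecI[of u "0\<^sub>v n"] by auto
  then have "0 < (u $ i) * (u $ i)" by (auto simp: zero_less_mult_iff linorder_neq_iff)
  also have "\<dots> \<le> (\<Sum>i<n. (u $ i) * (u $ i))"
    using i by (intro member_le_sum) auto
  finally show ?thesis using assms by (simp add: scalar_prod_def lessThan_atLeast0)
qed

lemma scalar_prod_Cauchy_Schwarz:
  fixes u v :: "real Matrix.vec"
  assumes "dim_vec u = dim_vec v"
  shows "(u \<bullet> v)\<^sup>2 \<le> (u \<bullet> u) * (v \<bullet> v)"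
  using Cauchy_Schwarz_ineq_sum[of "\<lambda>i. u $ i" "\<lambda>i. v $ i" "{0..<dim_vec v}"] assms
  by (simp add: scalar_prod_def power2_eq_square)

lemma mult_mat_vec_bound:
  fixes B :: "real Matrix.mat"
  obtains c where "c > 0" "\<And>u. u \<in> carrier_vec (dim_col B) \<Longrightarrow> (B *\<^sub>v u) \<bullet> (B *\<^sub>v u) \<le> c * (u \<bullet> u)"
proof
  \<comment> \<open>The squared Frobenius norm; the 1 added to it keeps the constant positive for a
    zero or empty matrix.\<close>
  let ?c = "\<Sum>i<dim_row B. Matrix.row B i \<bullet> Matrix.row B i"
  show "0 < 1 + ?c" by (simp add: sum_nonneg scalar_prod_self_nonneg add_pos_nonneg)
  fix u :: "real Matrix.vec" assume u: "u \<in> carrier_vec (dim_col B)"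
  have "(B *\<^sub>v u) \<bullet> (B *\<^sub>v u) = (\<Sum>i<dim_row B. (Matrix.row B i \<bullet> u)\<^sup>2)"
    by (simp add: scalar_prod_def[of "B *\<^sub>v u"] lessThan_atLeast0 power2_eq_square)
  also have "\<dots> \<le> (\<Sum>i<dim_row B. (Matrix.row B i \<bullet> Matrix.row B i) * (u \<bullet> u))"
    using u by (intro sum_mono scalar_prod_Cauchy_Schwarz) simp
  also have "\<dots> \<le> (1 + ?c) * (u \<bullet> u)"
    by (simp add: sum_distrib_right[symmetric] distrib_right scalar_prod_self_nonneg)
  finally show "(B *\<^sub>v u) \<bullet> (B *\<^sub>v u) \<le> (1 + ?c) * (u \<bullet> u)" .
qed

lemma quadratic_form_bound:
  fixes B :: "real Matrix.mat"
  assumes B: "B \<in> carrier_mat n n"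
  obtains c where "c > 0" "\<And>u. u \<in> carrier_vec n \<Longrightarrow> \<bar>u \<bullet> (B *\<^sub>v u)\<bar> \<le> c * (u \<bullet> u)"
proof -
  obtain c where c: "c > 0" "\<And>u. u \<in> carrier_vec n \<Longrightarrow> (B *\<^sub>v u) \<bullet> (B *\<^sub>v u) \<le> c * (u \<bullet> u)"
    using mult_mat_vec_bound[of B] B by auto
  have "\<bar>u \<bullet> (B *\<^sub>v u)\<bar> \<le> sqrt c * (u \<bullet> u)" if u: "u \<in> carrier_vec n" for u
  proof -
    have "(u \<bullet> (B *\<^sub>v u))\<^sup>2 \<le> (u \<bullet> u) * ((B *\<^sub>v u) \<bullet> (B *\<^sub>v u))"
      using u B by (intro scalar_prod_Cauchy_Schwarz) simp
    also have "\<dots> \<le> (u \<bullet> u) * (c * (u \<bullet> u))"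
      using c(2)[OF u] scalar_prod_self_nonneg by (intro mult_left_mono)
    also have "\<dots> = (sqrt c * (u \<bullet> u))\<^sup>2"
      using c(1) by (simp add: power_mult_distrib) (simp add: power2_eq_square)
    finally have "\<bar>u \<bullet> (B *\<^sub>v u)\<bar> \<le> \<bar>sqrt c * (u \<bullet> u)\<bar>" by (simp only: abs_le_square_iff)
    then show ?thesis using c(1) scalar_prod_self_nonneg[of u] by (simp add: abs_mult)
  qed
  then show ?thesis using that[of "sqrt c"] c(1) by simp
qed

text \<open>At a unit vector the form is at most the length of the image, by Cauchy-Schwarz, hence
  at most the supremum; homogeneity does the rest. A real \<open>Sup\<close> dominates its elements
  only if the set is bounded, which is checked with the Frobenius bound.\<close>

lemma spectral_norm_ge_quadratic_form:
  assumes B: "B \<in> carrier_mat n n" and a: "a \<in> carrier_vec n"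
  shows "a \<bullet> (B *\<^sub>v a) \<le> spectral_norm B * (a \<bullet> a)"
proof (cases "a = 0\<^sub>v n")
  case True
  then show ?thesis using B by simp
next
  case False
  let ?S = "{sqrt ((B *\<^sub>v u) \<bullet> (B *\<^sub>v u)) | u. u \<in> carrier_vec (dim_col B) \<and> u \<bullet> u \<le> 1}"
  have pos: "0 < a \<bullet> a" using scalar_prod_self_pos[OF a False] .
  obtain c where c: "c > 0" "\<And>u. u \<in> carrier_vec (dim_col B) \<Longrightarrow> (B *\<^sub>v u) \<bullet> (B *\<^sub>v u) \<le> c * (u \<bullet> u)"
    using mult_mat_vec_bound[of B] by metis
  have "bdd_above ?S"
  proof (rule bdd_aboveI)
    fix r assume "r \<in> ?S"
    then obtain u where u: "u \<in> carrier_vec (dim_col B)" "u \<bullet> u \<le> 1"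
      and r: "r = sqrt ((B *\<^sub>v u) \<bullet> (B *\<^sub>v u))" by auto
    have "(B *\<^sub>v u) \<bullet> (B *\<^sub>v u) \<le> c"
      using order_trans[OF c(2)[OF u(1)] mult_left_mono[OF u(2), of c]] c(1) by simp
    then show "r \<le> sqrt c" unfolding r by simp
  qed
  moreover define t where "t = 1 / sqrt (a \<bullet> a)"
  have t: "t * t * (a \<bullet> a) = 1" using pos by (simp add: t_def field_simps)
  let ?u = "t \<cdot>\<^sub>v a"
  have u: "?u \<in> carrier_vec (dim_col B)" "?u \<bullet> ?u \<le> 1"
    using a B t by (auto simp: mult.assoc)
  ultimately have "sqrt ((B *\<^sub>v ?u) \<bullet> (B *\<^sub>v ?u)) \<le> spectral_norm B"
    unfolding spectral_norm_def by (intro cSup_upper) auto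
  moreover have "?u \<bullet> (B *\<^sub>v ?u) \<le> sqrt ((B *\<^sub>v ?u) \<bullet> (B *\<^sub>v ?u))"
  proof (rule real_le_rsqrt)
    have "(?u \<bullet> (B *\<^sub>v ?u))\<^sup>2 \<le> (?u \<bullet> ?u) * ((B *\<^sub>v ?u) \<bullet> (B *\<^sub>v ?u))"
      using a B by (intro scalar_prod_Cauchy_Schwarz) simp
    also have "\<dots> \<le> 1 * ((B *\<^sub>v ?u) \<bullet> (B *\<^sub>v ?u))"
      using u(2) scalar_prod_self_nonneg by (intro mult_right_mono)
    finally show "(?u \<bullet> (B *\<^sub>v ?u))\<^sup>2 \<le> (B *\<^sub>v ?u) \<bullet> (B *\<^sub>v ?u)" by simp
  qed
  moreover have "?u \<bullet> (B *\<^sub>v ?u) = t * t * (a \<bullet> (B *\<^sub>v a))"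
    using a B by (simp add: mult_mat_vec)
  ultimately have "t * t * (a \<bullet> (B *\<^sub>v a)) \<le> spectral_norm B" by linarith
  then have "(t * t * (a \<bullet> (B *\<^sub>v a))) * (a \<bullet> a) \<le> spectral_norm B * (a \<bullet> a)"
    using pos by simp
  moreover have "(t * t * (a \<bullet> (B *\<^sub>v a))) * (a \<bullet> a) = (t * t * (a \<bullet> a)) * (a \<bullet> (B *\<^sub>v a))"
    by (simp only: ac_simps)
  ultimately show ?thesis using t by simp
qed

lemma nonsingular_mat_inverse:
  fixes B :: "'a :: field Matrix.mat"
  assumes B: "B \<in> carrier_mat n n"
    and inj: "\<And>u. u \<in> carrier_vec n \<Longrightarrow> B *\<^sub>v u = 0\<^sub>v n \<Longrightarrow> u = 0\<^sub>v n"
  obtains B' where "mat_inverse B = Some B'" "B * B' = 1\<^sub>m n" "B' * B = 1\<^sub>m n" "B' \<in> carrier_mat n n"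
proof (cases "mat_inverse B")
  case None
  then have "B \<notin> Units (ring_mat TYPE('a) n ())" using mat_inverse(1)[OF B] by simp
  moreover have "Determinant.det B \<noteq> 0" using det_0_iff_vec_prod_zero_field[OF B] inj by blast
  ultimately show ?thesis using det_non_zero_imp_unit[OF B, where b = "()"] by blast
next
  case (Some B')
  then show ?thesis using mat_inverse(2)[OF B Some] that by blast
qed

section \<open>Smallest eigenvalues and Rayleigh quotients\<close>

lemma Rayleigh_ge_lambda_min:
  fixes G :: "real Matrix.mat"
  assumes G: "G \<in> carrier_mat n n" and sym: "transpose_mat G = G" and z: "z \<in> carrier_vec n"
  shows "lambda_min G * (z \<bullet> z) \<le> z \<bullet> (G *\<^sub>v z)"
proof (cases "z = 0\<^sub>v n")
  case True
  then show ?thesis using G by simp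
next
  case z0: False
  text \<open>The infimum \<open>m\<close> of the Rayleigh quotient is an eigenvalue: otherwise the positive
    semidefinite form of \<open>H = G - m\<close> is nonsingular, and the Cauchy--Schwarz inequality for it
    at \<open>u\<close> and \<open>H\<^sup>-\<^sup>1 u\<close> bounds it below by a positive multiple of \<open>u \<bullet> u\<close>.\<close>
  define S where "S = {(u \<bullet> (G *\<^sub>v u)) / (u \<bullet> u) | u. u \<in> carrier_vec n \<and> u \<noteq> 0\<^sub>v n}"
  define m where "m = Inf S"
  obtain c where c: "c > 0" "\<And>u. u \<in> carrier_vec n \<Longrightarrow> \<bar>u \<bullet> (G *\<^sub>v u)\<bar> \<le> c * (u \<bullet> u)"
    using quadratic_form_bound[OF G] by metis
  have bdd: "bdd_below S"
  proof (rule bdd_belowI)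
    fix r assume "r \<in> S"
    then obtain u where u: "u \<in> carrier_vec n" "u \<noteq> 0\<^sub>v n" "r = (u \<bullet> (G *\<^sub>v u)) / (u \<bullet> u)"
      by (auto simp: S_def)
    have "- c * (u \<bullet> u) \<le> u \<bullet> (G *\<^sub>v u)" using c(2)[OF u(1)] by simp
    then show "- c \<le> r" unfolding u(3) using scalar_prod_self_pos[OF u(1,2)]
      by (simp only: pos_le_divide_eq)
  qed
  have m: "m * (u \<bullet> u) \<le> u \<bullet> (G *\<^sub>v u)" if u: "u \<in> carrier_vec n" for u
  proof (cases "u = 0\<^sub>v n")
    case True
    then show ?thesis using G by simp
  next
    case False
    then have "m \<le> (u \<bullet> (G *\<^sub>v u)) / (u \<bullet> u)"
      unfolding m_def using bdd u by (intro cInf_lower) (auto simp: S_def)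
    then show ?thesis using scalar_prod_self_pos[OF u False] by (simp add: field_simps)
  qed
  \<comment> \<open>\<open>char_matrix G m\<close> is \<open>G\<close> minus \<open>m\<close> times
    the identity; it is singular exactly when \<open>m\<close> is an eigenvalue.\<close>
  define H where "H = char_matrix G m"
  have H: "H \<in> carrier_mat n n" using G by (simp add: H_def)
  have Hu: "H *\<^sub>v u = G *\<^sub>v u - m \<cdot>\<^sub>v u" if "u \<in> carrier_vec n" for u
  proof -
    have "H *\<^sub>v u = G *\<^sub>v u + ((- m) \<cdot>\<^sub>m 1\<^sub>m n) *\<^sub>v u"
      using G that unfolding H_def char_matrix_def by (simp add: add_mult_distrib_mat_vec[of _ n n])
    also have "((- m) \<cdot>\<^sub>m 1\<^sub>m n) *\<^sub>v u = (- m) \<cdot>\<^sub>v u"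
      using that by (intro eq_vecI) auto
    finally show ?thesis using that G by (intro eq_vecI) auto
  qed
  have qH: "u \<bullet> (H *\<^sub>v w) = u \<bullet> (G *\<^sub>v w) - m * (u \<bullet> w)"
    if "u \<in> carrier_vec n" "w \<in> carrier_vec n" for u w
    using that G by (simp add: Hu scalar_prod_minus_distrib[of _ n])
  have symH: "u \<bullet> (H *\<^sub>v w) = w \<bullet> (H *\<^sub>v u)"
    if "u \<in> carrier_vec n" "w \<in> carrier_vec n" for u w
  proof -
    have "u \<bullet> (G *\<^sub>v w) = (transpose_mat G *\<^sub>v u) \<bullet> w"
      by (rule transpose_vec_mult_scalar[OF G that(2,1), symmetric])
    also have "\<dots> = w \<bullet> (G *\<^sub>v u)" unfolding sym using that G by (intro comm_scalar_prod) auto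
    finally show ?thesis using that by (simp add: qH comm_scalar_prod[of u n w])
  qed
  have psd: "0 \<le> u \<bullet> (H *\<^sub>v u)" if "u \<in> carrier_vec n" for u
    using m[OF that] qH[OF that that] by simp
  \<comment> \<open>Cauchy-Schwarz for a form known only to be semidefinite: its values along the
    line \<open>u - s w\<close> are a nonnegative quadratic in \<open>s\<close>.\<close>
  have CS: "(u \<bullet> (H *\<^sub>v w))\<^sup>2 \<le> (u \<bullet> (H *\<^sub>v u)) * (w \<bullet> (H *\<^sub>v w))"
    if u: "u \<in> carrier_vec n" and w: "w \<in> carrier_vec n" for u w
  proof (rule quadratic_nonneg_imp)
    fix s
    have "0 \<le> (u - s \<cdot>\<^sub>v w) \<bullet> (H *\<^sub>v (u - s \<cdot>\<^sub>v w))" using u w by (intro psd) simp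
    also have "H *\<^sub>v (u - s \<cdot>\<^sub>v w) = H *\<^sub>v u - s \<cdot>\<^sub>v (H *\<^sub>v w)"
      using u w H by (simp add: mult_minus_distrib_mat_vec[of _ n n] mult_mat_vec)
    also have "(u - s \<cdot>\<^sub>v w) \<bullet> (H *\<^sub>v u - s \<cdot>\<^sub>v (H *\<^sub>v w)) =
      u \<bullet> (H *\<^sub>v u) - 2 * s * (u \<bullet> (H *\<^sub>v w)) + s\<^sup>2 * (w \<bullet> (H *\<^sub>v w))"
      using u w H symH[OF u w]
      by (simp add: scalar_prod_minus_distrib[of _ n] minus_scalar_prod_distrib[of _ n]
          power2_eq_square algebra_simps)
    finally show "0 \<le> \<dots>" .
  qed (use psd w in auto)
  have "eigenvalue G m"
  proof (rule ccontr)
    assume "\<not> eigenvalue G m"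
    then have "Determinant.det H \<noteq> 0" using eigenvalue_det[OF G] H_def by blast
    then have "\<And>u. u \<in> carrier_vec n \<Longrightarrow> H *\<^sub>v u = 0\<^sub>v n \<Longrightarrow> u = 0\<^sub>v n"
      using det_0_iff_vec_prod_zero_field[OF H] by blast
    from nonsingular_mat_inverse[OF H this] obtain B where
      B: "H * B = 1\<^sub>m n" "B \<in> carrier_mat n n" by blast
    obtain d where d: "d > 0" "\<And>u. u \<in> carrier_vec n \<Longrightarrow> \<bar>u \<bullet> (B *\<^sub>v u)\<bar> \<le> d * (u \<bullet> u)"
      using quadratic_form_bound[OF B(2)] by metis
    have "m + 1 / d \<le> r" if r: "r \<in> S" for r
    proof -
      obtain u where u: "u \<in> carrier_vec n" "u \<noteq> 0\<^sub>v n" "r = (u \<bullet> (G *\<^sub>v u)) / (u \<bullet> u)"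
        using r by (auto simp: S_def)
      have pos: "0 < u \<bullet> u" using scalar_prod_self_pos u by blast
      have Bu: "B *\<^sub>v u \<in> carrier_vec n" using B(2) u(1) by simp
      have HB: "H *\<^sub>v (B *\<^sub>v u) = u"
        using assoc_mult_mat_vec[OF H B(2) u(1)] B(1) u(1) by simp
      have "(u \<bullet> u) * (u \<bullet> u) \<le> (u \<bullet> (H *\<^sub>v u)) * ((B *\<^sub>v u) \<bullet> u)"
        using CS[OF u(1) Bu] by (simp add: HB power2_eq_square)
      also have "(B *\<^sub>v u) \<bullet> u = u \<bullet> (B *\<^sub>v u)"
        by (rule comm_scalar_prod[OF Bu u(1)])
      also have "(u \<bullet> (H *\<^sub>v u)) * (u \<bullet> (B *\<^sub>v u)) \<le> (u \<bullet> (H *\<^sub>v u)) * (d * (u \<bullet> u))"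
        using d(2)[OF u(1)] psd[OF u(1)] by (intro mult_left_mono) auto
      finally have "u \<bullet> u \<le> d * (u \<bullet> (H *\<^sub>v u))" using pos by (simp add: mult.assoc[symmetric] mult.commute)
      then have "(1 / d) * (u \<bullet> u) \<le> u \<bullet> (G *\<^sub>v u) - m * (u \<bullet> u)"
        using d(1) by (simp add: qH[OF u(1) u(1)] field_simps)
      then have "(m + 1 / d) * (u \<bullet> u) \<le> u \<bullet> (G *\<^sub>v u)" by (simp add: distrib_right)
      then show ?thesis using pos by (simp add: u(3) pos_le_divide_eq)
    qed
    moreover have "S \<noteq> {}" using z z0 by (auto simp: S_def)
    ultimately have "m + 1 / d \<le> m" unfolding m_def by (intro cInf_greatest)
    then show False using d(1) by simp
  qed
  \<comment> \<open>Membership of \<open>m\<close> in the spectrum suffices: the minimum is then at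
    most \<open>m\<close>, which lies below every Rayleigh quotient.\<close>
  then have "lambda_min G \<le> m"
    unfolding lambda_min_def using card_finite_spectrum(1)[OF G]
    by (intro Min_le) (auto simp: spectrum_def)
  then have "lambda_min G * (z \<bullet> z) \<le> m * (z \<bullet> z)"
    using scalar_prod_self_nonneg by (intro mult_right_mono)
  also have "\<dots> \<le> z \<bullet> (G *\<^sub>v z)" using m[OF z] .
  finally show ?thesis .
qed

text \<open>\<open>a\<close> is the image under \<open>B\<close> of the solution \<open>z\<close> of
  the normal equations with right-hand side \<open>p\<close>, so
  \<open>a \<bullet> a = z \<bullet> p\<close>. The Rayleigh bound on \<open>z \<bullet> z\<close>
  and Cauchy-Schwarz for \<open>z \<bullet> p\<close> bound this by \<open>p \<bullet> p\<close>
  over the smallest eigenvalue: strong loadings let a short combination of outputs read off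
  \<open>p\<close>.\<close>

lemma exists_small_left_preimage:
  fixes B :: "real Matrix.mat"
  assumes B: "B \<in> carrier_mat N n" and pos: "0 < lambda_min (transpose_mat B * B)"
    and p: "p \<in> carrier_vec n"
  obtains a where "a \<in> carrier_vec N" "transpose_mat B *\<^sub>v a = p"
    "lambda_min (transpose_mat B * B) * (a \<bullet> a) \<le> p \<bullet> p"
proof -
  let ?G = "transpose_mat B * B"
  let ?l = "lambda_min ?G"
  have G: "?G \<in> carrier_mat n n" using B by simp
  have sym: "transpose_mat ?G = ?G" using B by (simp add: transpose_mult[of _ n N])
  have qG: "z \<bullet> (?G *\<^sub>v z) = (B *\<^sub>v z) \<bullet> (B *\<^sub>v z)" if "z \<in> carrier_vec n" for z
  proof -
    have Bz: "B *\<^sub>v z \<in> carrier_vec N" and BBz: "transpose_mat B *\<^sub>v (B *\<^sub>v z) \<in> carrier_vec n"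
      using that B by auto
    have "?G *\<^sub>v z = transpose_mat B *\<^sub>v (B *\<^sub>v z)"
      using that B by (intro assoc_mult_mat_vec[of _ n N _ n]) auto
    then show ?thesis
      using transpose_vec_mult_scalar[OF B that Bz] comm_scalar_prod[OF that BBz] by simp
  qed
  note R = Rayleigh_ge_lambda_min[OF G sym]
  have "u = 0\<^sub>v n" if "u \<in> carrier_vec n" "?G *\<^sub>v u = 0\<^sub>v n" for u
  proof (rule ccontr)
    assume "u \<noteq> 0\<^sub>v n"
    from mult_pos_pos[OF pos scalar_prod_self_pos[OF that(1) this]] R[OF that(1)] that
    show False by simp
  qed
  from nonsingular_mat_inverse[OF G this] obtain G' where
    G': "?G * G' = 1\<^sub>m n" "G' \<in> carrier_mat n n" by blast
  define z where "z = G' *\<^sub>v p"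
  have z: "z \<in> carrier_vec n" using G' p by (simp add: z_def)
  have Gz: "?G *\<^sub>v z = p"
    using assoc_mult_mat_vec[OF G G'(2) p] G'(1) p unfolding z_def by simp
  show ?thesis
  proof (rule that)
    show "B *\<^sub>v z \<in> carrier_vec N" using B z by simp
    show "transpose_mat B *\<^sub>v (B *\<^sub>v z) = p"
      using assoc_mult_mat_vec[of "transpose_mat B" n N B n z] Gz B z by simp
    have a: "(B *\<^sub>v z) \<bullet> (B *\<^sub>v z) = z \<bullet> p" using qG[OF z] Gz by simp
    have lz: "?l * (z \<bullet> z) \<le> z \<bullet> p" using R[OF z] Gz by simp
    have CS: "(z \<bullet> p)\<^sup>2 \<le> (z \<bullet> z) * (p \<bullet> p)"
      using z p by (intro scalar_prod_Cauchy_Schwarz) simp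
    show "?l * ((B *\<^sub>v z) \<bullet> (B *\<^sub>v z)) \<le> p \<bullet> p"
    proof (cases "z \<bullet> p = 0")
      case True
      then show ?thesis using a by (simp add: scalar_prod_self_nonneg)
    next
      case False
      then have zp: "z \<bullet> p > 0" using a scalar_prod_self_nonneg[of "B *\<^sub>v z"] by simp
      have "?l * (z \<bullet> p)\<^sup>2 \<le> ?l * ((z \<bullet> z) * (p \<bullet> p))" using CS pos by simp
      also have "\<dots> = (?l * (z \<bullet> z)) * (p \<bullet> p)" by simp
      also have "\<dots> \<le> (z \<bullet> p) * (p \<bullet> p)"
        using lz scalar_prod_self_nonneg by (intro mult_right_mono)
      finally show ?thesis using zp a by (simp add: power2_eq_square mult.left_commute)
    qed
  qed
qed

section \<open>Decay of the powers of a stable matrix\<close>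

lemma pow_mat_smult:
  fixes B :: "'a :: comm_semiring_1 Matrix.mat"
  assumes B: "B \<in> carrier_mat n n"
  shows "(c \<cdot>\<^sub>m B) ^\<^sub>m k = c ^ k \<cdot>\<^sub>m B ^\<^sub>m k"
proof (induction k)
  case 0
  then show ?case using B by (intro eq_matI) auto
next
  case (Suc k)
  have Bk: "B ^\<^sub>m k \<in> carrier_mat n n" using B by simp
  have "(c \<cdot>\<^sub>m B) ^\<^sub>m Suc k = c ^ k \<cdot>\<^sub>m (B ^\<^sub>m k * (c \<cdot>\<^sub>m B))"
    using Suc mult_smult_assoc_mat[OF Bk, of "c \<cdot>\<^sub>m B" n "c ^ k"] B by simp
  also have "\<dots> = c ^ k \<cdot>\<^sub>m (c \<cdot>\<^sub>m (B ^\<^sub>m k * B))"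
    by (simp only: mult_smult_distrib[OF Bk B])
  also have "\<dots> = c ^ Suc k \<cdot>\<^sub>m B ^\<^sub>m Suc k"
    using B by (intro eq_matI) (auto simp: ac_simps)
  finally show ?case .
qed

lemma pow_mat_of_real:
  assumes "B \<in> carrier_mat n n"
  shows "map_mat complex_of_real B ^\<^sub>m k = map_mat complex_of_real (B ^\<^sub>m k)"
  using of_real_hom.mat_hom_pow[OF assms] by (rule sym)

lemma asymptotically_stable_pow_tendsto_0:
  assumes A: "A \<in> carrier_mat n n" and stable: "asymptotically_stable A" and ij: "i < n" "j < n"
  shows "(\<lambda>k. (A ^\<^sub>m k) $$ (i, j)) \<longlonglongrightarrow> 0"
proof -
  let ?A = "map_mat complex_of_real A"
  have A': "?A \<in> carrier_mat n n" using A by simp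
  have n: "n > 0" using ij by simp
  have "spectral_radius ?A < 1"
    using spectral_radius_mem_max(1)[OF A' n] stable
    by (auto simp: asymptotically_stable_def spectrum_def)
  moreover have sr0: "spectral_radius ?A \<ge> 0"
    using spectral_radius_mem_max(1)[OF A' n] by auto
  ultimately obtain r where r: "spectral_radius ?A < r" "r < 1" "0 < r"
    using dense[of "spectral_radius ?A" 1] by auto
  text \<open>Scaling by a number \<open>r < 1\<close> above the spectral radius keeps the powers bounded.\<close>
  let ?B = "complex_of_real (1 / r) \<cdot>\<^sub>m ?A"
  have B: "?B \<in> carrier_mat n n" using A by simp
  have "spectral_radius ?B < 1"
  proof -
    obtain ev where ev: "ev \<in> spectrum ?B" "spectral_radius ?B = norm ev"
      using spectral_radius_mem_max(1)[OF B n] by auto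
    then obtain u where u: "u \<in> carrier_vec n" "u \<noteq> 0\<^sub>v n" "?B *\<^sub>v u = ev \<cdot>\<^sub>v u"
      using B by (auto simp: spectrum_def eigenvalue_def eigenvector_def)
    \<comment> \<open>An eigenvalue \<open>ev\<close> of the scaled matrix gives the eigenvalue
      \<open>r * ev\<close> of \<open>?A\<close>, so \<open>r * norm ev\<close> is at most the
      spectral radius, which is below \<open>r\<close>.\<close>
    have "?A *\<^sub>v u = complex_of_real r \<cdot>\<^sub>v (?B *\<^sub>v u)"
      using r u(1) A by (intro eq_vecI) (auto simp: scalar_prod_def sum_distrib_left)
    also have "\<dots> = (of_real r * ev) \<cdot>\<^sub>v u" unfolding u(3) by (rule smult_smult_assoc)
    finally have "eigenvalue ?A (of_real r * ev)"
      using u A by (auto simp: eigenvalue_def eigenvector_def)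
    then have "norm (of_real r * ev) \<le> spectral_radius ?A"
      using spectral_radius_mem_max(2)[OF A' n] by (auto simp: spectrum_def)
    then have "r * norm ev \<le> spectral_radius ?A" using r(3) by (simp add: norm_mult)
    then have "r * norm ev < r * 1" using r(1) by linarith
    then have "norm ev < 1" by (rule mult_left_less_imp_less) (use r(3) in simp)
    then show ?thesis unfolding ev(2) .
  qed
  then obtain c where c: "\<And>k. norm_bound (?B ^\<^sub>m k) c"
    using spectral_radius_jnf_norm_bound_less_1_upper_triangular[OF B] by blast
  \<comment> \<open>Undoing the scaling turns bounded powers into geometric decay.\<close>
  have bound: "\<bar>(A ^\<^sub>m k) $$ (i, j)\<bar> \<le> c * r ^ k" for k
  proof -
    have Ak: "A ^\<^sub>m k \<in> carrier_mat n n" using A by simp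
    have "?B ^\<^sub>m k = of_real (1 / r) ^ k \<cdot>\<^sub>m map_mat complex_of_real (A ^\<^sub>m k)"
      using pow_mat_smult[OF A'] pow_mat_of_real[OF A] by simp
    then have "(?B ^\<^sub>m k) $$ (i, j) = of_real ((1 / r) ^ k * (A ^\<^sub>m k) $$ (i, j))"
      using carrier_matD[OF Ak] ij by simp
    moreover have "norm ((?B ^\<^sub>m k) $$ (i, j)) \<le> c"
      using c[of k] A ij by (auto simp: norm_bound_def)
    ultimately have "(1 / r) ^ k * \<bar>(A ^\<^sub>m k) $$ (i, j)\<bar> \<le> c"
      using r by (simp only: norm_of_real abs_mult) simp
    then show ?thesis using r by (simp add: field_simps)
  qed
  have "(\<lambda>k. c * r ^ k) \<longlonglongrightarrow> 0"
    using r by (intro tendsto_mult_right_zero LIMSEQ_realpow_zero) auto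
  then show ?thesis
    by (rule Lim_null_comparison[rotated]) (use bound in auto)
qed

text \<open>For \<open>Q = 0\<close> every block of the reachability matrix vanishes, so its rank is
  0 instead of \<open>n \<ge> 1\<close>.\<close>

lemma reachable_nonzero:
  assumes A: "A \<in> carrier_mat n n" and n: "n \<ge> 1" and reach: "reachable n A Q"
  shows "Q \<noteq> 0\<^sub>m n n"
proof
  assume Q: "Q = 0\<^sub>m n n"
  have "reachability_matrix n A Q = 0\<^sub>m n (n * n)"
  proof (rule eq_matI)
    fix i j assume "i < dim_row (0\<^sub>m n (n * n) :: real Matrix.mat)"
      "j < dim_col (0\<^sub>m n (n * n) :: real Matrix.mat)"
    then have ij: "i < n" "j < n * n" by auto
    have "A ^\<^sub>m (j div n) * Q = 0\<^sub>m n n" using A unfolding Q by simp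
    then show "reachability_matrix n A Q $$ (i, j) = 0\<^sub>m n (n * n) $$ (i, j)"
      using ij n by (simp add: reachability_matrix_def)
  qed (simp_all add: reachability_matrix_def)
  then show False using reach n vec_space.rank_0I[of n "n * n", where ?'a = real]
    by (simp add: reachable_def)
qed

lemma cov_mat_quadratic_form:
  assumes "\<And>i. i < d \<Longrightarrow> square_integrable M (z i)" and u: "u \<in> carrier_vec d"
  shows "u \<bullet> (cov_mat M d z *\<^sub>v u)
    = covar M (\<lambda>\<omega>. \<Sum>i<d. u $ i * z i \<omega>) (\<lambda>\<omega>. \<Sum>i<d. u $ i * z i \<omega>)"
proof -
  have c: "cov_mat M d z \<in> carrier_mat d d" by (simp add: cov_mat_def)
  have "u \<bullet> (cov_mat M d z *\<^sub>v u) = (\<Sum>i<d. u $ i * (cov_mat M d z *\<^sub>v u) $ i)"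
    by (simp add: scalar_prod_def lessThan_atLeast0 cov_mat_def)
  also have "\<dots> = (\<Sum>i<d. u $ i * (\<Sum>j<d. covar M (z i) (z j) * u $ j))"
    by (intro sum.cong refl) (simp add: mult_mat_vec_index_sum[OF c u], simp add: cov_mat_def)
  also have "\<dots> = covar M (\<lambda>\<omega>. \<Sum>i<d. u $ i * z i \<omega>) (\<lambda>\<omega>. \<Sum>i<d. u $ i * z i \<omega>)"
    using assms(1) by (simp add: covar_sum_left covar_sum_right covar_scale_left covar_scale_right
        square_integrable_sum square_integrable_scale sum_distrib_left mult.commute)
  finally show ?thesis .
qed

section \<open>Orthogonality of the noises to the past\<close>

lemma wide_sense_stationaryD:
  "wide_sense_stationary M I z \<Longrightarrow> i \<in> I \<Longrightarrow> j \<in> I \<Longrightarrow>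
   covar M (z (s + h) i) (z (t + h) j) = covar M (z s i) (z t j)"
  by (simp add: wide_sense_stationary_def)

context dgfa_model
begin

lemma
  shows sq_x: "i < n \<Longrightarrow> square_integrable M (x t i)"
    and sq_v: "i < n \<Longrightarrow> square_integrable M (v t i)"
    and sq_y: "square_integrable M (y t k)"
    and sq_w: "square_integrable M (w t k)"
  using L2_x L2_v L2_y L2_w by (simp_all add: zero_mean_L2_def)

lemma state_eq_component:
  assumes i: "i < n"
  shows "AE \<omega> in M. x (t + 1) i \<omega> = (\<Sum>j<n. A $$ (i, j) * x t j \<omega>) + v t i \<omega>"
  using state_eq[of t]
proof eventually_elim
  case (elim \<omega>)
  have f: "first n z \<omega> \<in> carrier_vec n" for z :: "nat \<Rightarrow> 'a \<Rightarrow> real" by (simp add: first_def)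
  have "x (t + 1) i \<omega> = (A *\<^sub>v first n (x t) \<omega> + first n (v t) \<omega>) $ i"
    unfolding elim[symmetric] using i by (simp add: first_def)
  also have "\<dots> = (A *\<^sub>v first n (x t) \<omega>) $ i + v t i \<omega>"
    using i A_carrier by (simp add: first_def)
  also have "(A *\<^sub>v first n (x t) \<omega>) $ i = (\<Sum>j<n. A $$ (i, j) * x t j \<omega>)"
    unfolding mult_mat_vec_index_sum[OF A_carrier f i] by (simp add: first_def)
  finally show ?case .
qed

lemma covar_xx_shift:
  "i < n \<Longrightarrow> j < n \<Longrightarrow> covar M (x (s + h) i) (x (t + h) j) = covar M (x s i) (x t j)"
  using wide_sense_stationaryD[OF stationary, of "Inl i" "Inl j"] by (simp add: InlI InrI)

lemma covar_xy_shift: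
  "i < n \<Longrightarrow> covar M (x (s + h) i) (y (t + h) k) = covar M (x s i) (y t k)"
  using wide_sense_stationaryD[OF stationary, of "Inl i" "Inr k"] by (simp add: InlI InrI)

lemma covar_yy_shift:
  "covar M (y (s + h) k) (y (t + h) l) = covar M (y s k) (y t l)"
  using wide_sense_stationaryD[OF stationary, of "Inr k" "Inr l"] by (simp add: InlI InrI)

lemma covar_ww_shift: "covar M (w (s + h) k) (w (t + h) l) = covar M (w s k) (w t l)"
  using white_w wide_sense_stationaryD[of M UNIV w] by (simp add: white_noise_def)

lemma covar_v: "i < n \<Longrightarrow> j < n \<Longrightarrow> covar M (v t i) (v t j) = Q $$ (i, j)"
  by (simp add: cov_v[of t, symmetric] cov_mat_def)

text \<open>The model equations hold almost surely; tested against an arbitrary \<open>V\<close>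
  they become exact identities between covariances.\<close>

lemma covar_state:
  assumes i: "i < n" and V: "square_integrable M V"
  shows "covar M (x (t + 1) i) V = (\<Sum>j<n. A $$ (i, j) * covar M (x t j) V) + covar M (v t i) V"
proof -
  have "covar M (x (t + 1) i) V
    = covar M (\<lambda>\<omega>. (\<Sum>j<n. A $$ (i, j) * x t j \<omega>) + v t i \<omega>) V"
    using i V state_eq_component[OF i, of t]
    by (intro covar_cong_AE) (auto intro!: sq_x sq_v square_integrable_add square_integrable_sum)
  also have "\<dots> = (\<Sum>j<n. covar M (\<lambda>\<omega>. A $$ (i, j) * x t j \<omega>) V) + covar M (v t i) V"
    using i V by (simp add: covar_add_left covar_sum_left sq_x sq_v square_integrable_sum square_integrable_scale)
  finally show ?thesis by (simp add: covar_scale_left)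
qed

lemma covar_output:
  assumes V: "square_integrable M V"
  shows "covar M (y t k) V = (\<Sum>j<n. C k j * covar M (x t j) V) + covar M (w t k) V"
proof -
  have "covar M (y t k) V = covar M (\<lambda>\<omega>. (\<Sum>j<n. C k j * x t j \<omega>) + w t k \<omega>) V"
    using V output_eq[of t k]
    by (intro covar_cong_AE) (auto intro!: sq_x sq_y sq_w square_integrable_add square_integrable_sum)
  also have "\<dots> = (\<Sum>j<n. covar M (\<lambda>\<omega>. C k j * x t j \<omega>) V) + covar M (w t k) V"
    using V by (simp add: covar_add_left covar_sum_left sq_x sq_w square_integrable_sum square_integrable_scale)
  finally show ?thesis by (simp add: covar_scale_left)
qed

text \<open>By the state equation \<open>E[x(s) V] = A\<^sup>k E[x(s - k) V]\<close>, which tends to zero with \<open>A\<^sup>k\<close>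
  as \<open>E[x(s - k) V]\<close> is bounded by stationarity.\<close>

lemma covar_state_eq_0:
  assumes V: "square_integrable M V" and i: "i < n"
    and orth: "\<And>r j. r < s \<Longrightarrow> j < n \<Longrightarrow> covar M (v r j) V = 0"
  shows "covar M (x s i) V = 0"
proof -
  define b where "b r = Matrix.vec n (\<lambda>i. covar M (x r i) V)" for r
  have b: "b r \<in> carrier_vec n" for r by (simp add: b_def)
  have step: "b (r + 1) = A *\<^sub>v b r" if "r < s" for r
  proof (rule eq_vecI)
    fix i assume "i < dim_vec (A *\<^sub>v b r)"
    then have i: "i < n" using A_carrier by simp
    then show "b (r + 1) $ i = (A *\<^sub>v b r) $ i"
      unfolding mult_mat_vec_index_sum[OF A_carrier b i]
      using covar_state[OF i V, of r] orth[OF that i] by (simp add: b_def)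
  qed (use A_carrier in \<open>simp add: b_def\<close>)
  have pow: "A ^\<^sub>m k \<in> carrier_mat n n" for k using A_carrier by simp
  have "b s = A ^\<^sub>m k *\<^sub>v b (s - int k)" for k
  proof (induction k)
    case 0
    then show ?case using A_carrier b by simp
  next
    case (Suc k)
    have "b (s - int k) = A *\<^sub>v b (s - int (Suc k))"
      using step[of "s - int (Suc k)"] by simp
    then show ?case using Suc assoc_mult_mat_vec[OF pow A_carrier b] by simp
  qed
  then have eq: "covar M (x s i) V
    = (\<Sum>j<n. (A ^\<^sub>m k) $$ (i, j) * covar M (x (s - int k) j) V)" for k
    using mult_mat_vec_index_sum[OF pow b i, of k "s - int k"] i by (simp add: b_def)
  have "(\<lambda>k. \<Sum>j<n. (A ^\<^sub>m k) $$ (i, j) * covar M (x (s - int k) j) V) \<longlonglongrightarrow> 0"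
  proof (rule tendsto_null_sum)
    fix j assume "j \<in> {..<n}"
    then have j: "j < n" by simp
    define D where "D = sqrt (covar M (x 0 j) (x 0 j) * covar M V V)"
    \<comment> \<open>Stationarity makes the variance of \<open>x r j\<close> independent of
      \<open>r\<close>, so the Cauchy-Schwarz bound is uniform over the infinite past.\<close>
    have D: "\<bar>covar M (x r j) V\<bar> \<le> D" for r
      using covar_Cauchy_Schwarz[OF sq_x[OF j] V, of r] covar_xx_shift[OF j j, of 0 r 0]
      by (simp add: D_def real_le_rsqrt)
    have "(\<lambda>k. \<bar>(A ^\<^sub>m k) $$ (i, j)\<bar> * D) \<longlonglongrightarrow> 0"
      using asymptotically_stable_pow_tendsto_0[OF A_carrier stable i j]
      by (intro tendsto_mult_left_zero tendsto_rabs_zero)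
    then show "(\<lambda>k. (A ^\<^sub>m k) $$ (i, j) * covar M (x (s - int k) j) V) \<longlonglongrightarrow> 0"
      by (rule Lim_null_comparison[rotated]) (simp add: abs_mult mult_left_mono D)
  qed
  \<comment> \<open>By \<open>eq\<close> all these sums equal the covariance in question, a constant
    sequence with limit 0.\<close>
  then show ?thesis by (simp flip: eq add: LIMSEQ_const_iff)
qed

text \<open>Only inputs strictly before \<open>s\<close> are felt by \<open>x s\<close>, so
  whiteness also covers the case \<open>s = t\<close>.\<close>

lemma covar_vx: "s \<le> t \<Longrightarrow> i < n \<Longrightarrow> j < n \<Longrightarrow> covar M (v t i) (x s j) = 0"
  using covar_state_eq_0[OF sq_v, of i j s t] white_v
  by (simp add: white_noise_def covar_commute[of M "v t i"])

lemma covar_wx: "j < n \<Longrightarrow> covar M (w t k) (x s j) = 0"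
  using covar_state_eq_0[OF sq_w, of j s t k] uncorrelated by (simp add: covar_commute[of M "w t k"])

text \<open>The case \<open>s = t\<close> is included: the newest input has not yet reached the
  output. This lag of one step is what keeps the prediction error away from zero.\<close>

lemma covar_vy: "s \<le> t \<Longrightarrow> i < n \<Longrightarrow> covar M (v t i) (y s k) = 0"
  using covar_output[OF sq_v, of i s k t] covar_vx[of s t i] uncorrelated[of i t s k]
  by (simp add: covar_commute[of M "v t i"])

text \<open>Here \<open>s < t\<close> is strict, since \<open>y t\<close> contains
  \<open>w t\<close>.\<close>

lemma covar_wy: "s < t \<Longrightarrow> covar M (w t k) (y s l) = 0"
  using covar_output[OF sq_w, of s l t k] covar_wx[of _ t k s] white_w
  by (simp add: white_noise_def covar_commute[of M "w t k"])

text \<open>By Cauchy-Schwarz a covariance matrix with zero diagonal is zero, which reachability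
  excludes for \<open>Q\<close>.\<close>

lemma Q_diag_pos: "\<exists>i<n. Q $$ (i, i) > 0"
proof (rule ccontr)
  assume *: "\<not> ?thesis"
  have diag: "covar M (v 0 i) (v 0 i) = 0" if "i < n" for i
    using * that covar_v[of i i 0] covar_self_nonneg[of M "v 0 i"] by (metis antisym_conv2)
  have "covar M (v 0 i) (v 0 j) = 0" if "i < n" "j < n" for i j
    using covar_Cauchy_Schwarz[OF sq_v[OF that(1)] sq_v[OF that(2)], of 0 0] diag[OF that(1)] by simp
  then have "Q = 0\<^sub>m n n"
    unfolding cov_v[of 0, symmetric] by (intro eq_matI) (auto simp: cov_mat_def)
  then show False
    using reachable_nonzero[OF A_carrier n_pos] minimal by (auto simp: minimal_realization_def)
qed

end

section \<open>The steady-state predictor\<close>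

text \<open>One truncation size \<open>N\<close> with an arbitrary version \<open>xh\<close> of its
  predictor; the theorem instantiates this for each \<open>N\<close>.\<close>

locale dgfa_predictor = dgfa_model +
  fixes N :: nat and xh :: "int \<Rightarrow> nat \<Rightarrow> 'a \<Rightarrow> real"
  assumes predictor: "kalman_predictor M n N x y xh"
    and N_pos: "N \<ge> 1"
begin

abbreviation past :: "int \<Rightarrow> ('a \<Rightarrow> real) set" where
  "past t \<equiv> strict_past N y t"

definition err :: "int \<Rightarrow> nat \<Rightarrow> 'a \<Rightarrow> real" where
  "err t i = (\<lambda>\<omega>. x t i \<omega> - xh t i \<omega>)"

abbreviation innov :: "int \<Rightarrow> nat \<Rightarrow> 'a \<Rightarrow> real" where
  "innov \<equiv> innovation n C y xh"

lemma innov_fun: "innov t k = (\<lambda>\<omega>. y t k \<omega> - (\<Sum>j<n. C k j * xh t j \<omega>))"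
  by (simp add: fun_eq_iff innovation_def)

lemma sq_past: "f \<in> past t \<Longrightarrow> square_integrable M f"
  by (auto simp: strict_past_def sq_y)

lemma past_mono: "s \<le> t \<Longrightarrow> past s \<subseteq> past t"
  by (force simp: strict_past_def)

lemma output_in_past: "s < t \<Longrightarrow> k < N \<Longrightarrow> y s k \<in> past t"
  by (auto simp: strict_past_def)

lemma xh_best: "i < n \<Longrightarrow> best_linear_estimate M (past t) (x t i) (xh t i)"
  using predictor by (simp add: kalman_predictor_def)

lemma xh_span: "i < n \<Longrightarrow> xh t i \<in> closed_lin_span M (past t)"
  using xh_best[of i t] by (simp add: best_linear_estimate_def)

lemma sq_xh: "i < n \<Longrightarrow> square_integrable M (xh t i)"
  using xh_span closed_lin_span_square_integrable by blast

lemma sq_err: "i < n \<Longrightarrow> square_integrable M (err t i)"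
  unfolding err_def by (intro square_integrable_diff sq_x sq_xh)

lemma sq_innov: "square_integrable M (innov t k)"
  unfolding innov_fun by (simp add: square_integrable_diff sq_y square_integrable_sum
      square_integrable_scale sq_xh)

lemma covar_err_past: "i < n \<Longrightarrow> Y \<in> closed_lin_span M (past t) \<Longrightarrow> covar M (err t i) Y = 0"
  unfolding err_def by (intro best_linear_estimate_orthogonal[OF sq_past sq_x xh_best])

text \<open>The past reaches up to \<open>y t\<close>, because \<open>v t\<close> is uncorrelated
  with the simultaneous output as well.\<close>

lemma covar_v_past:
  "i < n \<Longrightarrow> Y \<in> closed_lin_span M (past (t + 1)) \<Longrightarrow> covar M (v t i) Y = 0"
  by (rule closed_lin_span_orthogonal[of "past (t + 1)", OF sq_past sq_v], assumption)
    (auto simp: strict_past_def covar_vy)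

lemma covar_w_past: "Y \<in> closed_lin_span M (past t) \<Longrightarrow> covar M (w t k) Y = 0"
  by (rule closed_lin_span_orthogonal[of "past t", OF sq_past sq_w], assumption)
    (auto simp: strict_past_def covar_wy)

lemma innov_span:
  assumes k: "k < N"
  shows "innov t k \<in> closed_lin_span M (past (t + 1))"
proof -
  have "y t k \<in> closed_lin_span M (past (t + 1))"
    using closed_lin_span_incl[OF sq_past output_in_past[OF _ k, of t "t + 1"]] by simp
  moreover have "xh t j \<in> closed_lin_span M (past (t + 1))" if "j < n" for j
    using xh_span[OF that] closed_lin_span_mono[OF past_mono, of t "t + 1" M] by auto
  ultimately show ?thesis unfolding innov_fun
    by (intro closed_lin_span_diff[OF sq_past] closed_lin_span_sum[OF sq_past]
        closed_lin_span_scale) auto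
qed

text \<open>\<open>w t\<close> is uncorrelated with the state and with the outputs before
  \<open>t\<close> that span the predictor. This removes the cross terms from the innovation
  covariance.\<close>

lemma covar_err_w:
  assumes i: "i < n"
  shows "covar M (err t i) (w t k) = 0"
  unfolding err_def using covar_w_past[OF xh_span[OF i]] covar_wx[OF i]
  by (subst covar_commute) (simp add: covar_diff_right sq_x sq_xh sq_w i)

lemma covar_innov:
  assumes V: "square_integrable M V"
  shows "covar M (innov t k) V = (\<Sum>j<n. C k j * covar M (err t j) V) + covar M (w t k) V"
proof -
  have "covar M (innov t k) V = covar M (y t k) V - (\<Sum>j<n. covar M (\<lambda>\<omega>. C k j * xh t j \<omega>) V)"
    unfolding innov_fun using V
    by (simp add: covar_diff_left covar_sum_left sq_xh sq_y square_integrable_sum square_integrable_scale)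
  also have "\<dots> = (\<Sum>j<n. C k j * (covar M (x t j) V - covar M (xh t j) V)) + covar M (w t k) V"
    by (simp add: covar_output[OF V] covar_scale_left right_diff_distrib sum_subtractf)
  also have "(\<Sum>j<n. C k j * (covar M (x t j) V - covar M (xh t j) V))
    = (\<Sum>j<n. C k j * covar M (err t j) V)"
    unfolding err_def using V by (intro sum.cong) (auto simp: covar_diff_left sq_x sq_xh)
  finally show ?thesis .
qed

section \<open>Time invariance of the error covariance\<close>

lemma strict_past_image: "past t = (\<lambda>(s, k). y (t + s) k) ` ({..-1} \<times> {..<N})"
proof (intro equalityI subsetI)
  fix f assume "f \<in> past t"
  then obtain s k where "f = y s k" "s \<le> t - 1" "k < N" by (auto simp: strict_past_def)
  then show "f \<in> (\<lambda>(s, k). y (t + s) k) ` ({..-1} \<times> {..<N})"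
    by (intro image_eqI[of _ _ "(s - t, k)"]) auto
next
  fix f assume "f \<in> (\<lambda>(s, k). y (t + s) k) ` ({..-1} \<times> {..<N})"
  then obtain s k where "f = y (t + s) k" "s \<le> -1" "k < N" by auto
  then show "f \<in> past t"
    unfolding strict_past_def by (intro CollectI exI[of _ "t + s"] exI[of _ k]) auto
qed

text \<open>The error variance of the best estimate of \<open>x\<^sub>i + x\<^sub>j\<close> is an infimum over the linear combinations
  of past outputs, and is therefore shift invariant; the error covariance follows by polarization.\<close>

lemma covar_err_sum_le:
  assumes i: "i < n" and j: "j < n"
  defines "E \<equiv> \<lambda>t \<omega>. err t i \<omega> + err t j \<omega>"
  shows "covar M (E t) (E t) \<le> covar M (E s) (E s)"
proof -
  define X where "X = (\<lambda>t \<omega>. x t i \<omega> + x t j \<omega>)"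
  define Z where "Z = (\<lambda>t \<omega>. xh t i \<omega> + xh t j \<omega>)"
  \<comment> \<open>Outputs are addressed by their lag, so that one index set serves all times and
    coefficients chosen at time \<open>s\<close> make sense at time \<open>t\<close>.\<close>
  define Y where "Y t = (\<lambda>(s, k). y (t + s) k)" for t
  have Zspan: "Z t \<in> closed_lin_span M (past t)" for t
    unfolding Z_def by (rule closed_lin_span_add[OF sq_past xh_span[OF i] xh_span[OF j]])
  have sqX: "square_integrable M (X t)" for t unfolding X_def by (intro square_integrable_add sq_x i j)
  have sqZ: "square_integrable M (Z t)" for t using closed_lin_span_square_integrable[OF Zspan] .
  have sqE: "square_integrable M (E t)" for t
    unfolding E_def by (intro square_integrable_add sq_err i j)
  have sqY: "square_integrable M (Y t p)" for t p by (simp add: Y_def split_def sq_y)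
  have past_Y: "past t = Y t ` ({..-1} \<times> {..<N})" for t
    unfolding Y_def by (rule strict_past_image)
  have E: "E t = (\<lambda>\<omega>. X t \<omega> - Z t \<omega>)" for t
    by (simp add: E_def X_def Z_def err_def fun_eq_iff)
  have orth: "covar M (E t) L = 0" if "L \<in> closed_lin_span M (past t)" for t L
    unfolding E_def using covar_err_past[OF i that] covar_err_past[OF j that]
    by (simp add: covar_add_left sq_err i j closed_lin_span_square_integrable[OF that])
  \<comment> \<open>Pythagoras: the residual of any competitor \<open>L\<close> splits orthogonally
    into the optimal residual and the distance from \<open>L\<close> to \<open>Z t\<close>.\<close>
  have split: "covar M (\<lambda>\<omega>. X t \<omega> - L \<omega>) (\<lambda>\<omega>. X t \<omega> - L \<omega>)
    = covar M (E t) (E t) + covar M (\<lambda>\<omega>. L \<omega> - Z t \<omega>) (\<lambda>\<omega>. L \<omega> - Z t \<omega>)"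
    if "L \<in> closed_lin_span M (past t)" for t L
  proof -
    have D: "(\<lambda>\<omega>. L \<omega> - Z t \<omega>) \<in> closed_lin_span M (past t)"
      using closed_lin_span_diff[OF sq_past that Zspan] .
    have "(\<lambda>\<omega>. X t \<omega> - L \<omega>) = (\<lambda>\<omega>. E t \<omega> - (L \<omega> - Z t \<omega>))" by (simp add: E)
    then show ?thesis
      using covar_diff_self[OF sqE closed_lin_span_square_integrable[OF D], of t] orth[OF D] by simp
  qed
  obtain S where S: "\<And>k. S k \<in> lin_combs (past s)" "ms_tendsto M S (Z s)"
    using Zspan[of s] by (auto simp: closed_lin_span_def)
  have le: "covar M (E t) (E t) \<le> covar M (E s) (E s)
    + covar M (\<lambda>\<omega>. S k \<omega> - Z s \<omega>) (\<lambda>\<omega>. S k \<omega> - Z s \<omega>)" for k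
  proof -
    have "S k \<in> lin_combs (Y s ` ({..-1} \<times> {..<N}))"
      using S(1)[of k] unfolding past_Y .
    then obtain I c where I: "finite I" "I \<subseteq> {..-1} \<times> {..<N}" and Sk: "S k = (\<lambda>\<omega>. \<Sum>p\<in>I. c p * Y s p \<omega>)"
      unfolding lin_combs_image by blast
    \<comment> \<open>The coefficients approximating \<open>Z s\<close> are applied to the outputs
      at time \<open>t\<close>; the competitor obtained there has the same second-order
      statistics.\<close>
    define L where "L t = (\<lambda>\<omega>. \<Sum>p\<in>I. c p * Y t p \<omega>)" for t
    have "L t \<in> lin_combs (past t)" for t
      unfolding past_Y L_def using I by (intro lin_combs_sum lin_combs_scale lin_combs_incl) auto
    then have L: "L t \<in> closed_lin_span M (past t)" for t
      by (rule subsetD[OF lin_combs_closed_lin_span, rotated]) (rule sq_past)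
    have sqL: "square_integrable M (L t)" for t using closed_lin_span_square_integrable[OF L] .
    have xy: "covar M (x t i) (Y t p) = covar M (x s i) (Y s p)" if "i < n" for i p
      using covar_xy_shift[OF that, of s "t - s" "s + fst p"] by (simp add: Y_def split_def algebra_simps)
    have yy: "covar M (Y t p) (Y t q) = covar M (Y s p) (Y s q)" for p q
      using covar_yy_shift[of "s + fst p" "t - s" "snd p" "s + fst q"]
      by (simp add: Y_def split_def algebra_simps)
    have xx: "covar M (x t i) (x t j) = covar M (x s i) (x s j)" if "i < n" "j < n" for i j
      using covar_xx_shift[OF that, of s "t - s" s] by simp
    have XX: "covar M (X t) (X t) = covar M (X s) (X s)"
      unfolding X_def using i j xx by (simp add: covar_add_self sq_x)
    have XL: "covar M (X t) (L t) = covar M (X s) (L s)"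
      unfolding X_def L_def using i j xy
      by (simp add: covar_add_left covar_sum_right covar_scale_right sq_x sqY
          square_integrable_add square_integrable_scale square_integrable_sum)
    have LL: "covar M (L t) (L t) = covar M (L s) (L s)"
      unfolding L_def using yy
      by (simp add: covar_sum_left covar_sum_right covar_scale_right covar_scale_left sqY
          square_integrable_scale square_integrable_sum)
    have "covar M (E t) (E t) \<le> covar M (\<lambda>\<omega>. X t \<omega> - L t \<omega>) (\<lambda>\<omega>. X t \<omega> - L t \<omega>)"
      unfolding split[OF L] by simp
    also have "\<dots> = covar M (\<lambda>\<omega>. X s \<omega> - L s \<omega>) (\<lambda>\<omega>. X s \<omega> - L s \<omega>)"
      by (simp add: covar_diff_self sqX sqL XX XL LL)
    also have "\<dots> = covar M (E s) (E s) + covar M (\<lambda>\<omega>. S k \<omega> - Z s \<omega>) (\<lambda>\<omega>. S k \<omega> - Z s \<omega>)"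
      unfolding split[OF L] by (simp add: L_def Sk)
    finally show ?thesis .
  qed
  \<comment> \<open>The excess over the optimum at \<open>s\<close> vanishes as the combinations
    approach \<open>Z s\<close>.\<close>
  have "(\<lambda>k. covar M (E s) (E s) + covar M (\<lambda>\<omega>. S k \<omega> - Z s \<omega>) (\<lambda>\<omega>. S k \<omega> - Z s \<omega>))
    \<longlonglongrightarrow> covar M (E s) (E s) + 0"
    by (rule tendsto_add[OF tendsto_const S(2)[unfolded ms_tendsto_covar]])
  then have "covar M (E t) (E t) \<le> covar M (E s) (E s) + 0"
    by (rule LIMSEQ_le_const) (intro exI[of _ 0] allI impI le)
  then show ?thesis by simp
qed

lemma covar_err_stationary:
  assumes i: "i < n" and j: "j < n"
  shows "covar M (err t i) (err t j) = covar M (err s i) (err s j)"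
proof -
  have *: "covar M (\<lambda>\<omega>. err t i \<omega> + err t j \<omega>) (\<lambda>\<omega>. err t i \<omega> + err t j \<omega>)
    = covar M (\<lambda>\<omega>. err s i \<omega> + err s j \<omega>) (\<lambda>\<omega>. err s i \<omega> + err s j \<omega>)"
    if "i < n" "j < n" for i j
    by (rule order.antisym[OF covar_err_sum_le[OF that] covar_err_sum_le[OF that]])
  \<comment> \<open>For \<open>i = j\<close> the sum is twice the error, which settles the variances
    that polarization subtracts.\<close>
  have "covar M (err t i) (err t i) = covar M (err s i) (err s i)" if "i < n" for i
    using *[OF that that] that by (simp add: covar_scale_left covar_scale_right)
  then show ?thesis using *[OF i j] i j by (simp add: covar_add_self sq_err)
qed

section \<open>Covariances of error and innovation\<close>

definition P :: "real Matrix.mat" where "P = cov_mat M n (err 0)"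
definition R :: "real Matrix.mat" where "R = cov_mat M N (w 0)"
definition \<Lambda> :: "real Matrix.mat" where "\<Lambda> = cov_mat M N (innov 0)"
abbreviation CN :: "real Matrix.mat" where "CN \<equiv> first_rows n N C"

lemma carriers: "P \<in> carrier_mat n n" "R \<in> carrier_mat N N" "\<Lambda> \<in> carrier_mat N N"
  "CN \<in> carrier_mat N n" "transpose_mat CN \<in> carrier_mat n N"
  by (simp_all add: P_def R_def \<Lambda>_def first_rows_def cov_mat_def)

lemma covar_err: "i < n \<Longrightarrow> j < n \<Longrightarrow> covar M (err t i) (err t j) = P $$ (i, j)"
  by (simp add: P_def cov_mat_def covar_err_stationary[of i j t 0])

lemma covar_err_innov:
  assumes i: "i < n" and k: "k < N"
  shows "covar M (err t i) (innov t k) = (P * transpose_mat CN) $$ (i, k)"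
proof -
  have "covar M (err t i) (innov t k) = (\<Sum>j<n. C k j * covar M (err t j) (err t i))"
    using covar_innov[OF sq_err[OF i], of t k t] covar_err_w[OF i, of t k]
    by (simp only: covar_commute[of M "err t i" "innov t k"] covar_commute[of M "err t i" "w t k"]
        add_0_right)
  also have "\<dots> = (\<Sum>j<n. P $$ (i, j) * C k j)"
    using i by (intro sum.cong refl) (simp add: covar_commute[of M _ "err t i"] covar_err)
  also have "\<dots> = (P * transpose_mat CN) $$ (i, k)"
    unfolding mult_mat_index_sum[OF carriers(1,5) i k] using k by (simp add: first_rows_def)
  finally show ?thesis .
qed

lemma covar_innov_innov:
  assumes k: "k < N" and l: "l < N"
  shows "covar M (innov t k) (innov t l) = (CN * (P * transpose_mat CN) + R) $$ (k, l)"
proof -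
  have PC: "P * transpose_mat CN \<in> carrier_mat n N" using carriers by simp
  have "covar M (w t k) (innov t l) = covar M (w t k) (w t l)"
    using covar_innov[OF sq_w, of t l t k] covar_err_w[of _ t k]
    by (simp add: covar_commute[of M "w t k"])
  also have "\<dots> = R $$ (k, l)"
    using covar_ww_shift[of 0 t k 0 l] k l by (simp add: R_def cov_mat_def)
  finally have "covar M (innov t k) (innov t l)
    = (\<Sum>j<n. C k j * (P * transpose_mat CN) $$ (j, l)) + R $$ (k, l)"
    by (simp add: covar_innov[OF sq_innov] covar_err_innov l)
  also have "(\<Sum>j<n. C k j * (P * transpose_mat CN) $$ (j, l)) = (CN * (P * transpose_mat CN)) $$ (k, l)"
    unfolding mult_mat_index_sum[OF carriers(4) PC k l] using k by (simp add: first_rows_def)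
  also have "\<dots> + R $$ (k, l) = (CN * (P * transpose_mat CN) + R) $$ (k, l)"
    using k l carriers(2) by (intro index_add_mat(1)[symmetric]) auto
  finally show ?thesis .
qed

lemma \<Lambda>_eq: "cov_mat M N (innov t) = CN * (P * transpose_mat CN) + R"
proof -
  let ?S = "CN * (P * transpose_mat CN) + R"
  have S: "?S \<in> carrier_mat N N" using carriers(2) by simp
  show ?thesis
  proof (rule eq_matI)
    fix k l assume "k < dim_row ?S" "l < dim_col ?S"
    then have "k < N" "l < N" unfolding carrier_matD[OF S] .
    then show "cov_mat M N (innov t) $$ (k, l) = ?S $$ (k, l)"
      unfolding covar_innov_innov[OF \<open>k < N\<close> \<open>l < N\<close>, of t, symmetric] by (simp add: cov_mat_def)
  qed (simp_all only: carrier_matD[OF S], simp_all add: cov_mat_def)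
qed

lemma \<Lambda>_stationary: "cov_mat M N (innov t) = \<Lambda>"
  by (simp only: \<Lambda>_eq \<Lambda>_def)

text \<open>The state error enters only through \<open>transpose_mat CN *\<^sub>v a\<close>:
  prescribing this vector selects an entry of \<open>P\<close>, to which the noise term can only
  add.\<close>

lemma \<Lambda>_quadratic_form:
  assumes a: "a \<in> carrier_vec N"
  shows "a \<bullet> (\<Lambda> *\<^sub>v a) = (transpose_mat CN *\<^sub>v a) \<bullet> (P *\<^sub>v (transpose_mat CN *\<^sub>v a)) + a \<bullet> (R *\<^sub>v a)"
proof -
  let ?p = "transpose_mat CN *\<^sub>v a"
  have p: "?p \<in> carrier_vec n" "P *\<^sub>v ?p \<in> carrier_vec n" using carriers a by auto
  have PC: "P * transpose_mat CN \<in> carrier_mat n N" using carriers by simp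
  have CPC: "CN * (P * transpose_mat CN) \<in> carrier_mat N N" using carriers by simp
  have "\<Lambda> *\<^sub>v a = CN *\<^sub>v (P *\<^sub>v ?p) + R *\<^sub>v a"
    unfolding \<Lambda>_def \<Lambda>_eq add_mult_distrib_mat_vec[OF CPC carriers(2) a]
      assoc_mult_mat_vec[OF carriers(4) PC a] assoc_mult_mat_vec[OF carriers(1,5) a] ..
  moreover have "CN *\<^sub>v (P *\<^sub>v ?p) \<in> carrier_vec N" "R *\<^sub>v a \<in> carrier_vec N"
    using mult_mat_vec_carrier[OF carriers(4) p(2)] mult_mat_vec_carrier[OF carriers(2) a] .
  ultimately show ?thesis
    by (simp only: transpose_vec_mult_scalar[OF carriers(4) p(2) a] scalar_prod_add_distrib[OF a])
qed

lemma R_form_nonneg: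
  "a \<in> carrier_vec N \<Longrightarrow> 0 \<le> a \<bullet> (R *\<^sub>v a)"
  "a \<in> carrier_vec N \<Longrightarrow> a \<noteq> 0\<^sub>v N \<Longrightarrow> 0 < a \<bullet> (R *\<^sub>v a)"
proof -
  show pos: "0 < a \<bullet> (R *\<^sub>v a)" if "a \<in> carrier_vec N" "a \<noteq> 0\<^sub>v N" for a
    using R_pos_def[OF N_pos] that carriers(2) unfolding pos_def_def R_def[symmetric] by auto
  show "0 \<le> a \<bullet> (R *\<^sub>v a)" if "a \<in> carrier_vec N" for a
    using pos[OF that] carriers(2) by (cases "a = 0\<^sub>v N") auto
qed

lemma P_form_nonneg: "u \<in> carrier_vec n \<Longrightarrow> 0 \<le> u \<bullet> (P *\<^sub>v u)"
  unfolding P_def by (simp add: cov_mat_quadratic_form sq_err)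

text \<open>\<open>\<Lambda>\<close> dominates the positive definite \<open>R\<close>, so the
  \<open>the\<close> in \<open>kalman_gain\<close> meets a genuine inverse.\<close>

lemma \<Lambda>_inverse:
  obtains B where "mat_inverse \<Lambda> = Some B" "B * \<Lambda> = 1\<^sub>m N" "B \<in> carrier_mat N N"
proof -
  have "u = 0\<^sub>v N" if u: "u \<in> carrier_vec N" "\<Lambda> *\<^sub>v u = 0\<^sub>v N" for u
  proof (rule ccontr)
    assume "u \<noteq> 0\<^sub>v N"
    then have "0 < u \<bullet> (\<Lambda> *\<^sub>v u)"
      unfolding \<Lambda>_quadratic_form[OF u(1)]
      using R_form_nonneg(2)[OF u(1)] P_form_nonneg[of "transpose_mat CN *\<^sub>v u"] carriers(5) u(1)
      by (auto intro!: add_nonneg_pos)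
    then show False using u by simp
  qed
  from nonsingular_mat_inverse[OF carriers(3) this] show ?thesis using that by blast
qed

section \<open>Kalman gain and innovation representation\<close>

abbreviation K :: "real Matrix.mat" where "K \<equiv> kalman_gain n N A C P \<Lambda>"

text \<open>\<open>K_\<Lambda>\<close> is the normal equation for regressing the new state on the
  innovation; the orthogonality proof uses the value of the gain only through it.\<close>

lemma gain:
  shows K_carrier: "K \<in> carrier_mat n N"
    and K_\<Lambda>: "K * \<Lambda> = A * (P * transpose_mat CN)"
proof -
  obtain B where B: "mat_inverse \<Lambda> = Some B" "B * \<Lambda> = 1\<^sub>m N" "B \<in> carrier_mat N N"
    using \<Lambda>_inverse .
  have AP: "A * P \<in> carrier_mat n n" and APC: "A * P * transpose_mat CN \<in> carrier_mat n N"
    using A_carrier carriers by auto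
  have K: "K = A * P * transpose_mat CN * B" by (simp add: kalman_gain_def B)
  show "K \<in> carrier_mat n N" unfolding K using APC B(3) by simp
  have "K * \<Lambda> = A * P * transpose_mat CN"
    unfolding K assoc_mult_mat[OF APC B(3) carriers(3)] B(2) by (rule right_mult_one_mat[OF APC])
  then show "K * \<Lambda> = A * (P * transpose_mat CN)"
    using assoc_mult_mat[OF A_carrier carriers(1,5)] by simp
qed

text \<open>The right-hand side of the predictor recursion, treated as a candidate for
  \<open>xh (t + 1)\<close> until its residual is shown to be orthogonal to the past.\<close>

definition xh_step :: "int \<Rightarrow> nat \<Rightarrow> 'a \<Rightarrow> real" where
  "xh_step t i = (\<lambda>\<omega>. (\<Sum>j<n. A $$ (i, j) * xh t j \<omega>) + (\<Sum>k<N. K $$ (i, k) * innov t k \<omega>))"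

lemma xh_step_span: "xh_step t i \<in> closed_lin_span M (past (t + 1))"
proof -
  have "xh t j \<in> closed_lin_span M (past (t + 1))" if "j < n" for j
    using xh_span[OF that] closed_lin_span_mono[OF past_mono, of t "t + 1" M] by auto
  then show ?thesis unfolding xh_step_def
    by (intro closed_lin_span_add[OF sq_past] closed_lin_span_sum[OF sq_past] closed_lin_span_scale)
      (auto intro: innov_span)
qed

text \<open>Almost surely the residual of the candidate is \<open>A err + v - K e\<close>; the
  identity records this in tested form.\<close>

lemma covar_xh_step_error:
  assumes i: "i < n" and V: "square_integrable M V"
  shows "covar M (\<lambda>\<omega>. x (t + 1) i \<omega> - xh_step t i \<omega>) V
    = (\<Sum>j<n. A $$ (i, j) * covar M (err t j) V) + covar M (v t i) V
      - (\<Sum>k<N. K $$ (i, k) * covar M (innov t k) V)"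
proof -
  have A: "square_integrable M (\<lambda>\<omega>. \<Sum>j<n. A $$ (i, j) * xh t j \<omega>)"
    by (auto intro!: sq_xh square_integrable_sum)
  have I: "square_integrable M (\<lambda>\<omega>. \<Sum>k<N. K $$ (i, k) * innov t k \<omega>)"
    by (auto intro!: sq_innov square_integrable_sum)
  have "covar M (xh_step t i) V = (\<Sum>j<n. A $$ (i, j) * covar M (xh t j) V)
      + (\<Sum>k<N. K $$ (i, k) * covar M (innov t k) V)"
    unfolding xh_step_def covar_add_left[OF A I V] using V
    by (simp add: covar_sum_left covar_scale_left sq_xh sq_innov square_integrable_scale)
  moreover have "covar M (\<lambda>\<omega>. x (t + 1) i \<omega> - xh_step t i \<omega>) V
    = covar M (x (t + 1) i) V - covar M (xh_step t i) V"
    using closed_lin_span_square_integrable[OF xh_step_span] i V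
    by (intro covar_diff_left) (auto intro: sq_x)
  moreover have "(\<Sum>j<n. A $$ (i, j) * covar M (err t j) V)
    = (\<Sum>j<n. A $$ (i, j) * covar M (x t j) V) - (\<Sum>j<n. A $$ (i, j) * covar M (xh t j) V)"
    unfolding sum_subtractf[symmetric] err_def using V
    by (intro sum.cong) (auto simp: covar_diff_left sq_x sq_xh right_diff_distrib)
  ultimately show ?thesis by (simp add: covar_state[OF i V])
qed

lemma xh_step_orthogonal_past:
  assumes i: "i < n" and V: "V \<in> closed_lin_span M (past t)"
  shows "covar M (\<lambda>\<omega>. x (t + 1) i \<omega> - xh_step t i \<omega>) V = 0"
proof -
  note sqV = closed_lin_span_square_integrable[OF V]
  have V': "V \<in> closed_lin_span M (past (t + 1))"
    using V closed_lin_span_mono[OF past_mono, of t "t + 1" M] by auto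
  show ?thesis
    by (simp add: covar_xh_step_error[OF i sqV] covar_err_past[OF _ V] covar_v_past[OF i V']
        covar_innov[OF sqV] covar_w_past[OF V])
qed

text \<open>The input drops out, and what remains is an entry of
  \<open>A * (P * transpose_mat CN) - K * \<Lambda>\<close>, zero by the normal equation.\<close>

lemma xh_step_orthogonal_innov:
  assumes i: "i < n" and k: "k < N"
  shows "covar M (\<lambda>\<omega>. x (t + 1) i \<omega> - xh_step t i \<omega>) (innov t k) = 0"
proof -
  have PC: "P * transpose_mat CN \<in> carrier_mat n N" using carriers by simp
  have "(\<Sum>j<n. A $$ (i, j) * covar M (err t j) (innov t k)) = (A * (P * transpose_mat CN)) $$ (i, k)"
    unfolding mult_mat_index_sum[OF A_carrier PC i k]
    by (intro sum.cong refl) (simp add: covar_err_innov k)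
  moreover have "(\<Sum>l<N. K $$ (i, l) * covar M (innov t l) (innov t k)) = (K * \<Lambda>) $$ (i, k)"
    unfolding mult_mat_index_sum[OF K_carrier carriers(3) i k]
    by (intro sum.cong refl) (use k in \<open>simp add: \<Lambda>_stationary[of t, symmetric] cov_mat_def\<close>)
  ultimately show ?thesis
    unfolding covar_xh_step_error[OF i sq_innov] K_\<Lambda> covar_v_past[OF i innov_span[OF k]] by simp
qed

text \<open>Older outputs lie in \<open>past t\<close>; the new output \<open>y t\<close> is the
  innovation plus a combination of \<open>xh t\<close>, and the residual is orthogonal to
  both.\<close>

lemma xh_step_orthogonal:
  assumes i: "i < n" and f: "f \<in> past (t + 1)"
  shows "covar M (\<lambda>\<omega>. x (t + 1) i \<omega> - xh_step t i \<omega>) f = 0"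
proof -
  let ?D = "\<lambda>\<omega>. x (t + 1) i \<omega> - xh_step t i \<omega>"
  have D: "square_integrable M ?D"
    using closed_lin_span_square_integrable[OF xh_step_span] sq_x[OF i] by auto
  obtain s k where f: "f = y s k" "s \<le> t" "k < N" using f by (auto simp: strict_past_def)
  show ?thesis
  proof (cases "s = t")
    case True
    have "covar M ?D (y t k) = covar M ?D (\<lambda>\<omega>. innov t k \<omega> + (\<Sum>j<n. C k j * xh t j \<omega>))"
      by (simp add: innov_fun)
    also have "\<dots> = covar M ?D (innov t k) + (\<Sum>j<n. C k j * covar M ?D (xh t j))"
      using D by (simp add: covar_add_right covar_sum_right covar_scale_right sq_innov sq_xh
          square_integrable_sum square_integrable_scale)
    also have "\<dots> = 0"
      using xh_step_orthogonal_innov[OF i f(3)] xh_step_orthogonal_past[OF i xh_span] by simp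
    finally show ?thesis using f True by simp
  next
    case False
    then have "f \<in> past t" using f output_in_past by simp
    then have "f \<in> closed_lin_span M (past t)"
      by (rule closed_lin_span_incl[OF sq_past, rotated])
    then show ?thesis by (rule xh_step_orthogonal_past[OF i])
  qed
qed

lemma xh_recursion: "i < n \<Longrightarrow> AE \<omega> in M. xh (t + 1) i \<omega> = xh_step t i \<omega>"
  by (rule best_linear_estimate_unique[of "past (t + 1)", OF sq_past sq_x xh_best xh_step_span xh_step_orthogonal])

lemma innovation_representation: "innovation_representation M n N A C K xh y innov"
  unfolding innovation_representation_def
proof
  fix t
  \<comment> \<open>Each component has its own null set; finitely many of them combine into
    one.\<close>
  have "AE \<omega> in M. \<forall>i\<in>{..<n}. xh (t + 1) i \<omega> = xh_step t i \<omega>"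
    using xh_recursion by (intro AE_finite_allI) auto
  then show "AE \<omega> in M. first n (xh (t + 1)) \<omega> = A *\<^sub>v first n (xh t) \<omega> + K *\<^sub>v first N (innov t) \<omega> \<and>
    first N (y t) \<omega> = CN *\<^sub>v first n (xh t) \<omega> + first N (innov t) \<omega>"
  proof eventually_elim
    case (elim \<omega>)
    have f: "first d z \<omega> \<in> carrier_vec d" for d and z :: "nat \<Rightarrow> 'a \<Rightarrow> real" by (simp add: first_def)
    have "first n (xh (t + 1)) \<omega> = A *\<^sub>v first n (xh t) \<omega> + K *\<^sub>v first N (innov t) \<omega>"
    proof (rule eq_vecI)
      fix i assume "i < dim_vec (A *\<^sub>v first n (xh t) \<omega> + K *\<^sub>v first N (innov t) \<omega>)"
      then have i: "i < n" using K_carrier by simp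
      then have "(A *\<^sub>v first n (xh t) \<omega> + K *\<^sub>v first N (innov t) \<omega>) $ i
        = (A *\<^sub>v first n (xh t) \<omega>) $ i + (K *\<^sub>v first N (innov t) \<omega>) $ i"
        using K_carrier by (intro index_add_vec(1)) simp
      also have "\<dots> = xh_step t i \<omega>"
        unfolding mult_mat_vec_index_sum[OF A_carrier f i] mult_mat_vec_index_sum[OF K_carrier f i]
        by (simp add: xh_step_def first_def)
      finally show "first n (xh (t + 1)) \<omega> $ i
        = (A *\<^sub>v first n (xh t) \<omega> + K *\<^sub>v first N (innov t) \<omega>) $ i"
        using elim i by (simp add: first_def)
    qed (use K_carrier in \<open>simp add: first_def\<close>)
    moreover have "first N (y t) \<omega> = CN *\<^sub>v first n (xh t) \<omega> + first N (innov t) \<omega>"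
    proof (rule eq_vecI)
      fix k assume "k < dim_vec (CN *\<^sub>v first n (xh t) \<omega> + first N (innov t) \<omega>)"
      then have k: "k < N" by (simp add: first_def)
      then have "(CN *\<^sub>v first n (xh t) \<omega> + first N (innov t) \<omega>) $ k
        = (CN *\<^sub>v first n (xh t) \<omega>) $ k + innov t k \<omega>"
        by (subst index_add_vec(1)) (simp_all add: first_def)
      also have "(CN *\<^sub>v first n (xh t) \<omega>) $ k = (\<Sum>j<n. C k j * xh t j \<omega>)"
        unfolding mult_mat_vec_index_sum[OF carriers(4) f k] using k by (simp add: first_def first_rows_def)
      finally show "first N (y t) \<omega> $ k = (CN *\<^sub>v first n (xh t) \<omega> + first N (innov t) \<omega>) $ k"
        using k by (simp add: first_def innov_fun)
    qed (simp add: first_def)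
    ultimately show ?case ..
  qed
qed

section \<open>Growth of the innovation covariance\<close>

lemma P_ge_Q:
  assumes i: "i < n"
  shows "Q $$ (i, i) \<le> P $$ (i, i)"
proof -
  \<comment> \<open>By the state equation the error at time 0 is \<open>v (-1) + W\<close>, and both
    parts of \<open>W\<close> are uncorrelated with \<open>v (-1)\<close>, so the variances
    add.\<close>
  define W where "W = (\<lambda>\<omega>. (\<Sum>j<n. A $$ (i, j) * x (-1) j \<omega>) - xh 0 i \<omega>)"
  have sqW: "square_integrable M W" unfolding W_def
    by (simp add: square_integrable_diff square_integrable_sum square_integrable_scale sq_x sq_xh i)
  have vW: "covar M (v (-1) i) W = 0"
    unfolding W_def using covar_vx[of "-1" "-1" i] covar_v_past[OF i, of "xh 0 i" "-1"] xh_span[OF i, of 0] i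
    by (simp add: covar_diff_right covar_sum_right covar_scale_right sq_x sq_xh sq_v
        square_integrable_sum square_integrable_scale)
  have "P $$ (i, i) = covar M (\<lambda>\<omega>. v (-1) i \<omega> + W \<omega>) (\<lambda>\<omega>. v (-1) i \<omega> + W \<omega>)"
    unfolding covar_err[OF i i, of 0, symmetric]
    using state_eq_component[OF i, of "-1"]
    by (intro covar_cong_AE sq_err i square_integrable_add sq_v sqW) (auto simp: err_def W_def)
  also have "\<dots> = Q $$ (i, i) + covar M W W"
    using covar_v[OF i i] by (simp add: covar_add_self sq_v i sqW vW)
  finally show ?thesis by simp
qed

lemma spectral_norm_\<Lambda>_ge:
  assumes i: "i < n" and Q: "Q $$ (i, i) > 0" and l: "lambda_min (transpose_mat CN * CN) > 0"
  shows "lambda_min (transpose_mat CN * CN) * Q $$ (i, i) \<le> spectral_norm \<Lambda>"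
proof -
  let ?l = "lambda_min (transpose_mat CN * CN)"
  let ?p = "unit_vec n i :: real Matrix.vec"
  have p: "?p \<in> carrier_vec n" by simp
  obtain a where a: "a \<in> carrier_vec N" "transpose_mat CN *\<^sub>v a = ?p" "?l * (a \<bullet> a) \<le> ?p \<bullet> ?p"
    using exists_small_left_preimage[OF carriers(4) l p] .
  have "?p \<bullet> (P *\<^sub>v ?p) = P $$ (i, i)"
    using i carriers(1) by simp
  then have "Q $$ (i, i) \<le> a \<bullet> (\<Lambda> *\<^sub>v a)"
    unfolding \<Lambda>_quadratic_form[OF a(1)] a(2) using P_ge_Q[OF i] R_form_nonneg(1)[OF a(1)] by simp
  also have "\<dots> \<le> spectral_norm \<Lambda> * (a \<bullet> a)"
    using spectral_norm_ge_quadratic_form[OF carriers(3) a(1)] .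
  finally have le: "Q $$ (i, i) \<le> spectral_norm \<Lambda> * (a \<bullet> a)" .
  \<comment> \<open>The sign is needed to multiply inequalities by the norm; it follows from
    \<open>le\<close>, whose left side is positive while \<open>a \<bullet> a\<close> is
    nonnegative.\<close>
  then have "0 < spectral_norm \<Lambda>"
    using Q scalar_prod_self_nonneg[of a] by (metis less_le_trans zero_less_mult_pos2 less_eq_real_def mult_zero_right not_less)
  then have "spectral_norm \<Lambda> * (?l * (a \<bullet> a)) \<le> spectral_norm \<Lambda> * 1"
    using a(3) i by (intro mult_left_mono) auto
  moreover have "?l * Q $$ (i, i) \<le> ?l * (spectral_norm \<Lambda> * (a \<bullet> a))"
    using le l by (intro mult_left_mono) auto
  ultimately show ?thesis by (simp add: mult.left_commute)
qed

end

theorem theorem1: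
  fixes M :: "'a measure"
    and n :: nat
    and A Q :: "real Matrix.mat"
    and C :: "nat \<Rightarrow> nat \<Rightarrow> real"
    and x v y w :: "int \<Rightarrow> nat \<Rightarrow> 'a \<Rightarrow> real"
    and xh e :: "nat \<Rightarrow> int \<Rightarrow> nat \<Rightarrow> 'a \<Rightarrow> real"
    and P \<Lambda> K :: "nat \<Rightarrow> real Matrix.mat"
  assumes model: "dgfa_model M n A Q C x v y w"
    and predictor: "\<And>N. N \<ge> 1 \<Longrightarrow> kalman_predictor M n N x y (xh N)"
    and e_def: "e = (\<lambda>N. innovation n C y (xh N))"
    and P_def: "P = (\<lambda>N. cov_mat M n (\<lambda>i \<omega>. x 0 i \<omega> - xh N 0 i \<omega>))"
    and \<Lambda>_def: "\<Lambda> = (\<lambda>N. cov_mat M N (e N 0))"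
    and K_def: "K = (\<lambda>N. kalman_gain n N A C (P N) (\<Lambda> N))"
  shows "(\<forall>N\<ge>1. innovation_representation M n N A C (K N) (xh N) y (e N)
                \<and> (\<forall>t. cov_mat M N (e N t) = \<Lambda> N))
       \<and> (\<forall>t. \<not> tends_to_idiosyncratic M (\<lambda>N. e N t))
       \<and> (SUP N\<in>{1..}. ereal (spectral_norm (\<Lambda> N))) = \<infinity>
       \<and> \<not> tends_to_legitimate_DGFA M n C e"
proof -
  interpret dgfa_model M n A Q C x v y w by (rule model)
  have pred: "dgfa_predictor M n A Q C x v y w N (xh N)" if "N \<ge> 1" for N
    by (intro dgfa_predictor.intro dgfa_predictor_axioms.intro model predictor that)
  have repr: "innovation_representation M n N A C (K N) (xh N) y (e N) \<and>
    (\<forall>t. cov_mat M N (e N t) = \<Lambda> N)" if "N \<ge> 1" for N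
  proof -
    interpret p: dgfa_predictor M n A Q C x v y w N "xh N" by (rule pred[OF that])
    have "P N = p.P" by (simp add: P_def p.P_def p.err_def cov_mat_def)
    moreover have "\<Lambda> N = p.\<Lambda>" by (simp add: \<Lambda>_def p.\<Lambda>_def e_def)
    ultimately show ?thesis
      using p.innovation_representation p.\<Lambda>_stationary by (simp add: K_def e_def)
  qed
  obtain i where i: "i < n" "Q $$ (i, i) > 0" using Q_diag_pos by blast
  let ?l = "\<lambda>N. lambda_min (transpose_mat (first_rows n N C) * first_rows n N C)"
  have bound: "?l N * Q $$ (i, i) \<le> spectral_norm (\<Lambda> N)" if N: "N \<ge> 1" "?l N > 0" for N
  proof -
    interpret p: dgfa_predictor M n A Q C x v y w N "xh N" by (rule pred[OF N(1)])
    have "\<Lambda> N = p.\<Lambda>" by (simp add: \<Lambda>_def p.\<Lambda>_def e_def)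
    then show ?thesis using p.spectral_norm_\<Lambda>_ge[OF i N(2)] by simp
  qed
  \<comment> \<open>In the threshold for the eigenvalue, the 1 secures the positivity required by
    \<open>bound\<close>, and \<open>B + 1\<close> makes the final inequality strict.\<close>
  have unbounded: "\<exists>N\<ge>1. spectral_norm (\<Lambda> N) > B" for B
  proof -
    have "\<forall>\<^sub>F N in sequentially. max 1 ((B + 1) / Q $$ (i, i)) \<le> ?l N \<and> N \<ge> 1"
      using loadings unfolding strongly_lin_indep_def
      by (intro eventually_conj eventually_ge_at_top) (simp only: filterlim_at_top)
    then obtain N where N: "max 1 ((B + 1) / Q $$ (i, i)) \<le> ?l N" "N \<ge> 1"
      using eventually_happens'[OF sequentially_bot] by blast
    then have "B + 1 \<le> ?l N * Q $$ (i, i)" using i(2) by (simp add: pos_divide_le_eq)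
    also have "\<dots> \<le> spectral_norm (\<Lambda> N)" using N by (intro bound) simp_all
    finally show ?thesis using N(2) by (intro exI[of _ N]) simp
  qed
  have not_idio: "\<not> tends_to_idiosyncratic M (\<lambda>N. e N t)" for t
  proof
    assume "tends_to_idiosyncratic M (\<lambda>N. e N t)"
    then obtain B where "\<forall>N\<ge>1. spectral_norm (\<Lambda> N) \<le> B"
      using repr by (auto simp: tends_to_idiosyncratic_def)
    with unbounded[of B] show False by (auto simp: not_le[symmetric])
  qed
  have "(SUP N\<in>{1..}. ereal (spectral_norm (\<Lambda> N))) = \<infinity>"
  proof (rule SUP_PInfty)
    fix m :: nat
    obtain N where "N \<ge> 1" "spectral_norm (\<Lambda> N) > real m" using unbounded by blast
    then show "\<exists>N\<in>{1..}. ereal (real m) \<le> ereal (spectral_norm (\<Lambda> N))"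
      by (intro bexI[of _ N]) simp_all
  qed
  with repr not_idio show ?thesis by (auto simp: tends_to_legitimate_DGFA_def)
qed

end
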